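(* Let $M$ be a 3-dimensional normal almost paracontact metric manifold with structure $(\varphi,\xi,\eta,g)$ and associated functions $\alpha,\beta$. Let $\gamma\colon I\to M$ be a slant Frenet curve of osculating order 3 in $M$, with $g(\dot\gamma,\dot\gamma)=\varepsilon_1=\pm1$ and $\eta(\dot\gamma)=c$ constant. Then the curvature $\kappa$ and torsion $\tau$ of $\gamma$ are given by $$\kappa=\sqrt{|\varepsilon_1-c^2|\,|\alpha^2-\varepsilon_1\delta^2|},$$ $$\tau=\Big|\operatorname{sgn}(1-\varepsilon_1c^2)\,\beta+c\,\delta+\frac{\alpha\dot\delta-\dot\alpha\delta}{\alpha^2-\varepsilon_1\delta^2}\Big|,$$ where $\delta=\dfrac{g(\nabla_{\dot\gamma}\dot\gamma,\varphi\dot\gamma)}{|\varepsilon_1-c^2|}$, and $\alpha,\beta$ stand for $\alpha\circ\gamma,\beta\circ\gamma$ (a dot denotes the derivative along $\gamma$).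
   Context: An almost paracontact structure on a $(2n+1)$-dimensional manifold $M$ is a triple $(\varphi,\xi,\eta)$ of a $(1,1)$-tensor field, a vector field and a 1-form with $\eta(\xi)=1$, $\varphi^2=\mathrm{Id}-\eta\otimes\xi$, and such that the eigendistributions of $\varphi$ on $\ker\eta$ for the eigenvalues $1$ and $-1$ both have dimension $n$. It is almost paracontact metric if $M$ also carries a pseudo-Riemannian metric $g$ of signature $(n+1,n)$ with $g(\varphi X,\varphi Y)=-g(X,Y)+\eta(X)\eta(Y)$; then $\eta(X)=g(X,\xi)$, $\varphi\xi=0$, $\eta\circ\varphi=0$, and $g(X,\varphi Y)$ is skew-symmetric. It is normal if $[\varphi,\varphi](X,Y)-2\,d\eta(X,Y)\xi=0$, where $[\varphi,\varphi](X,Y)=\varphi^2[X,Y]+[\varphi X,\varphi Y]-\varphi[\varphi X,Y]-\varphi[X,\varphi Y]$. Here $n=1$, $\nabla$ is the Levi-Civita connection of $g$, and it is known that normality is equivalent to the existence of functions $\alpha,\beta$ on $M$ with $\nabla_X\xi=\alpha(X-\eta(X)\xi)+\beta\varphi X$, and equivalent to $(\nabla_X\varphi)Y=\beta(g(X,Y)\xi-\eta(Y)X)+\alpha(g(\varphi X,Y)\xi-\eta(Y)\varphi X)$ for functions $\alpha,\beta$; these functions are given by $2\alpha=\mathrm{Trace}\{X\mapsto\nabla_X\xi\}$, $2\beta=\mathrm{Trace}\{X\mapsto\varphi\nabla_X\xi\}$. A curve $\gamma\colon I\to M$ ($I$ an interval) is slant if $g(\dot\gamma,\xi)=\eta(\dot\gamma)=c$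 is constant. A Frenet curve of osculating order 3 is a curve with $g(\dot\gamma,\dot\gamma)=\varepsilon_1=\pm1$ for which there exist orthonormal vector fields $E_1=\dot\gamma$, $E_2$, $E_3$ along $\gamma$ ($g(E_2,E_2)=\varepsilon_2=\pm1$, $g(E_3,E_3)=\varepsilon_3=\pm1$) and positive functions $\kappa$ (curvature), $\tau$ (torsion) along $\gamma$ such that $\nabla_{\dot\gamma}E_1=\kappa\varepsilon_2E_2$, $\nabla_{\dot\gamma}E_2=-\kappa\varepsilon_1E_1+\tau\varepsilon_3E_3$, $\nabla_{\dot\gamma}E_3=-\tau\varepsilon_2E_2$. For such a slant curve $\varepsilon_1-c^2\neq0$, so $\delta$ is well defined. *)

theory Defs
  imports "HOL-Analysis.Analysis"
begin

section \<open>Smooth maps between normed spaces\<close>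

text \<open>
  The sets on which these notions are used are open sets and relatively open subsets of a
  nondegenerate real interval.  On such sets the derivative within the set is unique; on an
  interval it is the one-sided derivative at an end point that belongs to the interval.
\<close>

primrec Ck_on :: "nat \<Rightarrow> ('a::real_normed_vector \<Rightarrow> 'b::real_normed_vector) \<Rightarrow> 'a set \<Rightarrow> bool" where
  "Ck_on 0 f S \<longleftrightarrow> continuous_on S f"
| "Ck_on (Suc k) f S \<longleftrightarrow> f differentiable_on S \<and>
     (\<forall>v. Ck_on k (\<lambda>x. frechet_derivative f (at x within S) v) S)"

definition smooth_on :: "('a::real_normed_vector \<Rightarrow> 'b::real_normed_vector) \<Rightarrow> 'a set \<Rightarrow> bool" where
  "smooth_on f S \<longleftrightarrow> (\<forall>k. Ck_on k f S)"


section \<open>Smooth 3-manifolds\<close>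

text \<open>
  The manifold is a whole type \<open>'a\<close>, Hausdorff and second countable by its type classes; its
  smooth structure is given by an atlas (not necessarily maximal).
\<close>

type_synonym 'a chart = "'a set \<times> ('a \<Rightarrow> real^3)"

abbreviation chart_dom :: "'a chart \<Rightarrow> 'a set" where
  "chart_dom c \<equiv> fst c"

abbreviation coord :: "'a chart \<Rightarrow> 'a \<Rightarrow> real^3" where
  "coord c \<equiv> snd c"

abbreviation param :: "'a chart \<Rightarrow> real^3 \<Rightarrow> 'a" where
  "param c \<equiv> inv_into (chart_dom c) (coord c)"

definition smooth_atlas :: "'a::{t2_space, second_countable_topology} chart set \<Rightarrow> bool" where
  "smooth_atlas A \<longleftrightarrow>
     (\<Union>c\<in>A. chart_dom c) = UNIV \<and>
     (\<forall>c\<in>A. open (chart_dom c) \<and> open (coord c ` chart_dom c) \<and>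
        homeomorphism (chart_dom c) (coord c ` chart_dom c) (coord c) (param c)) \<and>
     (\<forall>c\<in>A. \<forall>d\<in>A. smooth_on (coord d \<circ> param c) (coord c ` (chart_dom c \<inter> chart_dom d)))"

definition chart_at :: "'a chart set \<Rightarrow> 'a \<Rightarrow> 'a chart" where
  "chart_at A p = (SOME c. c \<in> A \<and> p \<in> chart_dom c)"


section \<open>Tangent vectors\<close>

text \<open>
  A tangent vector at \<open>p\<close> assigns to every chart of the atlas around \<open>p\<close> a coordinate vector, in
  such a way that the coordinate vectors in different charts correspond under the derivatives of
  the transition maps.  The type below collects arbitrary assignments of coordinate vectors to
  charts with the pointwise linear structure; the tangent spaces are subspaces of it.
\<close>

typedef 'a tvec = "UNIV :: ('a chart \<Rightarrow> real^3) set"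
  morphisms coords Tvec
  by simp

lemma coords_Tvec [simp]: "coords (Tvec f) = f"
  by (simp add: Tvec_inverse)

lemma tvec_eqI: "(\<And>c. coords u c = coords v c) \<Longrightarrow> u = v"
  by (metis coords_inject ext)

instantiation tvec :: (type) real_vector
begin

definition "0 = Tvec (\<lambda>c. 0)"
definition "u + v = Tvec (\<lambda>c. coords u c + coords v c)"
definition "u - v = Tvec (\<lambda>c. coords u c - coords v c)"
definition "- v = Tvec (\<lambda>c. - coords v c)"
definition "r *\<^sub>R v = Tvec (\<lambda>c. r *\<^sub>R coords v c)"

instance
  by standard
    (auto intro!: tvec_eqI simp: zero_tvec_def plus_tvec_def minus_tvec_def uminus_tvec_def
      scaleR_tvec_def algebra_simps)

end

text \<open>The tangent vector at \<open>p\<close> whose coordinate vector in the chart \<open>c\<close> is \<open>w\<close>.\<close>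

definition chart_vector :: "'a chart set \<Rightarrow> 'a chart \<Rightarrow> 'a \<Rightarrow> real^3 \<Rightarrow> 'a tvec" where
  "chart_vector A c p w =
     Tvec (\<lambda>d. if d \<in> A \<and> p \<in> chart_dom d
                then frechet_derivative (coord d \<circ> param c) (at (coord c p)) w else 0)"

definition tangent_space :: "'a chart set \<Rightarrow> 'a \<Rightarrow> 'a tvec set" where
  "tangent_space A p =
     {v. \<forall>c\<in>A. p \<in> chart_dom c \<longrightarrow> v = chart_vector A c p (coords v c)}"

definition coord_field :: "'a chart set \<Rightarrow> 'a chart \<Rightarrow> 3 \<Rightarrow> 'a \<Rightarrow> 'a tvec" where
  "coord_field A c i p = chart_vector A c p (axis i 1)"

definition dir_deriv :: "'a chart set \<Rightarrow> 'a \<Rightarrow> 'a tvec \<Rightarrow> ('a \<Rightarrow> real) \<Rightarrow> real" where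
  "dir_deriv A p v f =
     (let c = chart_at A p in frechet_derivative (f \<circ> param c) (at (coord c p)) (coords v c))"

definition tangent_trace :: "'a chart set \<Rightarrow> 'a \<Rightarrow> ('a tvec \<Rightarrow> 'a tvec) \<Rightarrow> real" where
  "tangent_trace A p F =
     (let c = chart_at A p in trace (matrix (\<lambda>w. coords (F (chart_vector A c p w)) c)))"


section \<open>Functions, vector fields and tensor fields\<close>

definition smooth_fun_on :: "'a chart set \<Rightarrow> 'a set \<Rightarrow> ('a \<Rightarrow> real) \<Rightarrow> bool" where
  "smooth_fun_on A U f \<longleftrightarrow> (\<forall>c\<in>A. smooth_on (f \<circ> param c) (coord c ` (chart_dom c \<inter> U)))"

definition vfield_on :: "'a chart set \<Rightarrow> 'a set \<Rightarrow> ('a \<Rightarrow> 'a tvec) \<Rightarrow> bool" where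
  "vfield_on A U X \<longleftrightarrow>
     (\<forall>p\<in>U. X p \<in> tangent_space A p) \<and>
     (\<forall>c\<in>A. smooth_on (\<lambda>z. coords (X (param c z)) c) (coord c ` (chart_dom c \<inter> U)))"

definition lie_bracket ::
    "'a chart set \<Rightarrow> ('a \<Rightarrow> 'a tvec) \<Rightarrow> ('a \<Rightarrow> 'a tvec) \<Rightarrow> 'a \<Rightarrow> 'a tvec" where
  "lie_bracket A X Y p =
     Tvec (\<lambda>c. if c \<in> A \<and> p \<in> chart_dom c
       then frechet_derivative (\<lambda>z. coords (Y (param c z)) c) (at (coord c p)) (coords (X p) c)
          - frechet_derivative (\<lambda>z. coords (X (param c z)) c) (at (coord c p)) (coords (Y p) c)
       else 0)"

definition lin_on :: "'v::real_vector set \<Rightarrow> ('v \<Rightarrow> 'w::real_vector) \<Rightarrow> bool" where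
  "lin_on S f \<longleftrightarrow>
     (\<forall>u\<in>S. \<forall>v\<in>S. \<forall>a b. f (a *\<^sub>R u + b *\<^sub>R v) = a *\<^sub>R f u + b *\<^sub>R f v)"

text \<open>Smoothness of a tensor field is tested on local smooth vector fields.\<close>

definition endo_field :: "'a::topological_space chart set \<Rightarrow> ('a \<Rightarrow> 'a tvec \<Rightarrow> 'a tvec) \<Rightarrow> bool" where
  "endo_field A F \<longleftrightarrow>
     (\<forall>p. F p ` tangent_space A p \<subseteq> tangent_space A p \<and> lin_on (tangent_space A p) (F p)) \<and>
     (\<forall>U X. open U \<longrightarrow> vfield_on A U X \<longrightarrow> vfield_on A U (\<lambda>p. F p (X p)))"

definition one_form :: "'a::topological_space chart set \<Rightarrow> ('a \<Rightarrow> 'a tvec \<Rightarrow> real) \<Rightarrow> bool" where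
  "one_form A w \<longleftrightarrow>
     (\<forall>p. lin_on (tangent_space A p) (w p)) \<and>
     (\<forall>U X. open U \<longrightarrow> vfield_on A U X \<longrightarrow> smooth_fun_on A U (\<lambda>p. w p (X p)))"

text \<open>The convention for the exterior derivative is the one with the factor \<open>1/2\<close>.\<close>

definition ext_deriv ::
    "'a chart set \<Rightarrow> ('a \<Rightarrow> 'a tvec \<Rightarrow> real) \<Rightarrow> ('a \<Rightarrow> 'a tvec) \<Rightarrow> ('a \<Rightarrow> 'a tvec) \<Rightarrow> 'a \<Rightarrow> real" where
  "ext_deriv A w X Y p =
     (1/2) * (dir_deriv A p (X p) (\<lambda>q. w q (Y q)) - dir_deriv A p (Y p) (\<lambda>q. w q (X q))
              - w p (lie_bracket A X Y p))"


section \<open>Pseudo-Riemannian metrics and the Levi-Civita connection\<close>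

text \<open>Signature \<open>(k, l)\<close>: there is a basis of \<open>S\<close>, orthonormal for \<open>G\<close>, of \<open>k\<close> spacelike and \<open>l\<close>
  timelike vectors.\<close>

definition has_signature ::
    "'v::real_vector set \<Rightarrow> ('v \<Rightarrow> 'v \<Rightarrow> real) \<Rightarrow> nat \<Rightarrow> nat \<Rightarrow> bool" where
  "has_signature S G k l \<longleftrightarrow>
     (\<exists>e. (\<forall>i<k+l. e i \<in> S) \<and> span (e ` {..<k+l}) = S \<and>
        (\<forall>i<k+l. \<forall>j<k+l. G (e i) (e j) = (if i \<noteq> j then 0 else if i < k then 1 else -1)))"

definition pseudo_riemannian ::
    "'a::topological_space chart set \<Rightarrow> nat \<Rightarrow> nat \<Rightarrow> ('a \<Rightarrow> 'a tvec \<Rightarrow> 'a tvec \<Rightarrow> real) \<Rightarrow> bool" where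
  "pseudo_riemannian A k l g \<longleftrightarrow>
     (\<forall>p. \<forall>u\<in>tangent_space A p. lin_on (tangent_space A p) (g p u) \<and>
            (\<forall>v\<in>tangent_space A p. g p u v = g p v u)) \<and>
     (\<forall>p. has_signature (tangent_space A p) (g p) k l) \<and>
     (\<forall>U X Y. open U \<longrightarrow> vfield_on A U X \<longrightarrow> vfield_on A U Y \<longrightarrow>
            smooth_fun_on A U (\<lambda>p. g p (X p) (Y p)))"

text \<open>
  A connection \<open>D\<close> differentiates a vector field \<open>Y\<close>, defined and smooth near \<open>p\<close>, in the direction
  of a tangent vector \<open>v\<close> at \<open>p\<close>; \<open>D p v Y\<close> stands for \<open>\<nabla>\<^sub>v Y\<close>.  Vector fields
  are total functions, but the axioms force \<open>D p v Y\<close> to depend only on the germ of \<open>Y\<close> at \<open>p\<close>: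
  apply the Leibniz rule to the function that is \<open>1\<close> on a small neighbourhood of \<open>p\<close> and \<open>0\<close>
  elsewhere.
\<close>

type_synonym 'a connection = "'a \<Rightarrow> 'a tvec \<Rightarrow> ('a \<Rightarrow> 'a tvec) \<Rightarrow> 'a tvec"

definition affine_connection :: "'a::topological_space chart set \<Rightarrow> 'a connection \<Rightarrow> bool" where
  "affine_connection A D \<longleftrightarrow>
     (\<forall>U Y. open U \<longrightarrow> vfield_on A U Y \<longrightarrow>
        (\<forall>p\<in>U. (\<forall>v\<in>tangent_space A p. D p v Y \<in> tangent_space A p) \<and>
                lin_on (tangent_space A p) (\<lambda>v. D p v Y)) \<and>
        (\<forall>X. vfield_on A U X \<longrightarrow> vfield_on A U (\<lambda>p. D p (X p) Y)) \<and>
        (\<forall>Z. vfield_on A U Z \<longrightarrow>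
           (\<forall>p\<in>U. \<forall>v\<in>tangent_space A p. D p v (\<lambda>q. Y q + Z q) = D p v Y + D p v Z)) \<and>
        (\<forall>f. smooth_fun_on A U f \<longrightarrow>
           (\<forall>p\<in>U. \<forall>v\<in>tangent_space A p.
              D p v (\<lambda>q. f q *\<^sub>R Y q) = dir_deriv A p v f *\<^sub>R Y p + f p *\<^sub>R D p v Y)))"

definition levi_civita ::
    "'a::topological_space chart set \<Rightarrow> ('a \<Rightarrow> 'a tvec \<Rightarrow> 'a tvec \<Rightarrow> real) \<Rightarrow> 'a connection \<Rightarrow> bool" where
  "levi_civita A g D \<longleftrightarrow>
     affine_connection A D \<and>
     (\<forall>U X Y. open U \<longrightarrow> vfield_on A U X \<longrightarrow> vfield_on A U Y \<longrightarrow>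
        (\<forall>p\<in>U. D p (X p) Y - D p (Y p) X = lie_bracket A X Y p \<and>
           (\<forall>v\<in>tangent_space A p.
              dir_deriv A p v (\<lambda>q. g q (X q) (Y q)) = g p (D p v X) (Y p) + g p (X p) (D p v Y))))"


section \<open>Almost paracontact metric structures\<close>

definition almost_paracontact ::
    "'a::topological_space chart set \<Rightarrow> ('a \<Rightarrow> 'a tvec \<Rightarrow> 'a tvec) \<Rightarrow> ('a \<Rightarrow> 'a tvec) \<Rightarrow>
     ('a \<Rightarrow> 'a tvec \<Rightarrow> real) \<Rightarrow> bool" where
  "almost_paracontact A \<phi> \<xi> \<eta> \<longleftrightarrow>
     endo_field A \<phi> \<and> vfield_on A UNIV \<xi> \<and> one_form A \<eta> \<and>
     (\<forall>p. \<eta> p (\<xi> p) = 1 \<and>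
        (\<forall>v\<in>tangent_space A p. \<phi> p (\<phi> p v) = v - \<eta> p v *\<^sub>R \<xi> p) \<and>
        dim {v \<in> tangent_space A p. \<eta> p v = 0 \<and> \<phi> p v = v} = 1 \<and>
        dim {v \<in> tangent_space A p. \<eta> p v = 0 \<and> \<phi> p v = - v} = 1)"

definition almost_paracontact_metric ::
    "'a::topological_space chart set \<Rightarrow> ('a \<Rightarrow> 'a tvec \<Rightarrow> 'a tvec) \<Rightarrow> ('a \<Rightarrow> 'a tvec) \<Rightarrow>
     ('a \<Rightarrow> 'a tvec \<Rightarrow> real) \<Rightarrow> ('a \<Rightarrow> 'a tvec \<Rightarrow> 'a tvec \<Rightarrow> real) \<Rightarrow> bool" where
  "almost_paracontact_metric A \<phi> \<xi> \<eta> g \<longleftrightarrow>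
     almost_paracontact A \<phi> \<xi> \<eta> \<and> pseudo_riemannian A 2 1 g \<and>
     (\<forall>p. \<forall>u\<in>tangent_space A p. \<forall>v\<in>tangent_space A p.
        g p (\<phi> p u) (\<phi> p v) = - g p u v + \<eta> p u * \<eta> p v)"

definition nijenhuis ::
    "'a chart set \<Rightarrow> ('a \<Rightarrow> 'a tvec \<Rightarrow> 'a tvec) \<Rightarrow>
     ('a \<Rightarrow> 'a tvec) \<Rightarrow> ('a \<Rightarrow> 'a tvec) \<Rightarrow> 'a \<Rightarrow> 'a tvec" where
  "nijenhuis A \<phi> X Y p =
     \<phi> p (\<phi> p (lie_bracket A X Y p))
     + lie_bracket A (\<lambda>q. \<phi> q (X q)) (\<lambda>q. \<phi> q (Y q)) p
     - \<phi> p (lie_bracket A (\<lambda>q. \<phi> q (X q)) Y p)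
     - \<phi> p (lie_bracket A X (\<lambda>q. \<phi> q (Y q)) p)"

definition normal_structure ::
    "'a::topological_space chart set \<Rightarrow> ('a \<Rightarrow> 'a tvec \<Rightarrow> 'a tvec) \<Rightarrow> ('a \<Rightarrow> 'a tvec) \<Rightarrow>
     ('a \<Rightarrow> 'a tvec \<Rightarrow> real) \<Rightarrow> bool" where
  "normal_structure A \<phi> \<xi> \<eta> \<longleftrightarrow>
     (\<forall>U X Y. open U \<longrightarrow> vfield_on A U X \<longrightarrow> vfield_on A U Y \<longrightarrow>
        (\<forall>p\<in>U. nijenhuis A \<phi> X Y p - (2 * ext_deriv A \<eta> X Y p) *\<^sub>R \<xi> p = 0))"

text \<open>
  The functions \<open>\<alpha>\<close>, \<open>\<beta>\<close> associated with a normal structure, given by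
  \<open>2\<alpha> = Trace (X \<mapsto> \<nabla>\<^sub>X \<xi>)\<close> and \<open>2\<beta> = Trace (X \<mapsto> \<phi> \<nabla>\<^sub>X \<xi>)\<close>.
\<close>

definition assoc_alpha :: "'a chart set \<Rightarrow> 'a connection \<Rightarrow> ('a \<Rightarrow> 'a tvec) \<Rightarrow> 'a \<Rightarrow> real" where
  "assoc_alpha A D \<xi> p = tangent_trace A p (\<lambda>v. D p v \<xi>) / 2"

definition assoc_beta ::
    "'a chart set \<Rightarrow> 'a connection \<Rightarrow> ('a \<Rightarrow> 'a tvec \<Rightarrow> 'a tvec) \<Rightarrow> ('a \<Rightarrow> 'a tvec) \<Rightarrow> 'a \<Rightarrow> real" where
  "assoc_beta A D \<phi> \<xi> p = tangent_trace A p (\<lambda>v. \<phi> p (D p v \<xi>)) / 2"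


section \<open>Curves\<close>

definition nondegenerate_interval :: "real set \<Rightarrow> bool" where
  "nondegenerate_interval I \<longleftrightarrow> is_interval I \<and> (\<exists>a\<in>I. \<exists>b\<in>I. a < b)"

definition smooth_curve :: "'a::topological_space chart set \<Rightarrow> real set \<Rightarrow> (real \<Rightarrow> 'a) \<Rightarrow> bool" where
  "smooth_curve A I \<gamma> \<longleftrightarrow>
     continuous_on I \<gamma> \<and> (\<forall>c\<in>A. smooth_on (coord c \<circ> \<gamma>) {t \<in> I. \<gamma> t \<in> chart_dom c})"

definition velocity :: "'a chart set \<Rightarrow> real set \<Rightarrow> (real \<Rightarrow> 'a) \<Rightarrow> real \<Rightarrow> 'a tvec" where
  "velocity A I \<gamma> t =
     Tvec (\<lambda>c. if c \<in> A \<and> \<gamma> t \<in> chart_dom c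
                then vector_derivative (coord c \<circ> \<gamma>) (at t within I) else 0)"

definition vfield_along ::
    "'a chart set \<Rightarrow> real set \<Rightarrow> (real \<Rightarrow> 'a) \<Rightarrow> (real \<Rightarrow> 'a tvec) \<Rightarrow> bool" where
  "vfield_along A I \<gamma> V \<longleftrightarrow>
     (\<forall>t\<in>I. V t \<in> tangent_space A (\<gamma> t)) \<and>
     (\<forall>c\<in>A. smooth_on (\<lambda>t. coords (V t) c) {t \<in> I. \<gamma> t \<in> chart_dom c})"

text \<open>
  The covariant derivative of a vector field along a curve: if \<open>V = (\<Sum>i. V\<^sup>i \<partial>\<^sub>i)\<close> in a chart
  around \<open>\<gamma> t\<close>, it is \<open>(\<Sum>i. (dV\<^sup>i/dt) \<partial>\<^sub>i + V\<^sup>i \<nabla>\<^sub>\<gamma>\<^sub>' \<partial>\<^sub>i)\<close>.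
\<close>

definition cov_deriv ::
    "'a chart set \<Rightarrow> 'a connection \<Rightarrow> real set \<Rightarrow> (real \<Rightarrow> 'a) \<Rightarrow> (real \<Rightarrow> 'a tvec) \<Rightarrow>
     real \<Rightarrow> 'a tvec" where
  "cov_deriv A D I \<gamma> V t =
     (let c = chart_at A (\<gamma> t)
      in chart_vector A c (\<gamma> t) (vector_derivative (\<lambda>s. coords (V s) c) (at t within I))
         + (\<Sum>i\<in>UNIV. (coords (V t) c $ i) *\<^sub>R D (\<gamma> t) (velocity A I \<gamma> t) (coord_field A c i)))"

definition slant_curve ::
    "'a chart set \<Rightarrow> ('a \<Rightarrow> 'a tvec \<Rightarrow> real) \<Rightarrow> real set \<Rightarrow> (real \<Rightarrow> 'a) \<Rightarrow> real \<Rightarrow> bool" where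
  "slant_curve A \<eta> I \<gamma> c \<longleftrightarrow> (\<forall>t\<in>I. \<eta> (\<gamma> t) (velocity A I \<gamma> t) = c)"

definition frenet_curve3 ::
    "'a::topological_space chart set \<Rightarrow> ('a \<Rightarrow> 'a tvec \<Rightarrow> 'a tvec \<Rightarrow> real) \<Rightarrow> 'a connection \<Rightarrow>
     real set \<Rightarrow> (real \<Rightarrow> 'a) \<Rightarrow> (real \<Rightarrow> 'a tvec) \<Rightarrow> (real \<Rightarrow> 'a tvec) \<Rightarrow>
     real \<Rightarrow> real \<Rightarrow> real \<Rightarrow> (real \<Rightarrow> real) \<Rightarrow> (real \<Rightarrow> real) \<Rightarrow> bool" where
  "frenet_curve3 A g D I \<gamma> E\<^sub>2 E\<^sub>3 \<epsilon>\<^sub>1 \<epsilon>\<^sub>2 \<epsilon>\<^sub>3 \<kappa> \<tau> \<longleftrightarrow>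
     (let E\<^sub>1 = velocity A I \<gamma> in
      smooth_curve A I \<gamma> \<and> vfield_along A I \<gamma> E\<^sub>2 \<and> vfield_along A I \<gamma> E\<^sub>3 \<and>
      \<epsilon>\<^sub>1 \<in> {1, -1} \<and> \<epsilon>\<^sub>2 \<in> {1, -1} \<and> \<epsilon>\<^sub>3 \<in> {1, -1} \<and>
      smooth_on \<kappa> I \<and> smooth_on \<tau> I \<and>
      (\<forall>t\<in>I.
         g (\<gamma> t) (E\<^sub>1 t) (E\<^sub>1 t) = \<epsilon>\<^sub>1 \<and> g (\<gamma> t) (E\<^sub>2 t) (E\<^sub>2 t) = \<epsilon>\<^sub>2 \<and> g (\<gamma> t) (E\<^sub>3 t) (E\<^sub>3 t) = \<epsilon>\<^sub>3 \<and>
         g (\<gamma> t) (E\<^sub>1 t) (E\<^sub>2 t) = 0 \<and> g (\<gamma> t) (E\<^sub>1 t) (E\<^sub>3 t) = 0 \<and> g (\<gamma> t) (E\<^sub>2 t) (E\<^sub>3 t) = 0 \<and>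
         \<kappa> t > 0 \<and> \<tau> t > 0 \<and>
         cov_deriv A D I \<gamma> E\<^sub>1 t = (\<kappa> t * \<epsilon>\<^sub>2) *\<^sub>R E\<^sub>2 t \<and>
         cov_deriv A D I \<gamma> E\<^sub>2 t = - (\<kappa> t * \<epsilon>\<^sub>1) *\<^sub>R E\<^sub>1 t + (\<tau> t * \<epsilon>\<^sub>3) *\<^sub>R E\<^sub>3 t \<and>
         cov_deriv A D I \<gamma> E\<^sub>3 t = - (\<tau> t * \<epsilon>\<^sub>2) *\<^sub>R E\<^sub>2 t))"

end

theory Submission
  imports Defs
begin

text \<open>
  The velocity \<open>E\<^sub>1\<close> has fixed scalar products with itself and with \<open>\<xi>\<close>, so all the information about
  a slant Frenet curve sits in the four functions \<open>x\<^sub>i = \<eta>(E\<^sub>i)\<close> and \<open>p\<^sub>i = g(E\<^sub>i, \<phi> E\<^sub>1)\<close>, \<open>i = 2, 3\<close>.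
  Put \<open>q = \<epsilon>\<^sub>1 - c\<^sup>2\<close>.

  Differentiate \<open>\<eta>(E\<^sub>i) = g(E\<^sub>i, \<xi>)\<close> along the curve, using the Frenet equations and
  \<open>\<nabla>\<^sub>X \<xi> = \<alpha> (X - \<eta>(X) \<xi>) + \<beta> \<phi> X\<close> (lemma \<open>D_xi\<close>). For \<open>i = 1\<close>, where \<open>\<eta>(E\<^sub>1) = c\<close> is constant,
  this gives \<open>\<kappa> \<epsilon>\<^sub>2 x\<^sub>2 = - \<alpha> q\<close>; for \<open>i = 2, 3\<close> it gives first order equations for \<open>x\<^sub>2\<close> and \<open>x\<^sub>3\<close>. The
  case \<open>q = 0\<close> is impossible, as these equations would force \<open>\<kappa> = 0\<close>. The definition of
  \<open>\<delta>\<close> reads \<open>\<delta> \<bar>q\<bar> = \<kappa> \<epsilon>\<^sub>2 p\<^sub>2\<close>.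

  In the plane orthogonal to \<open>E\<^sub>1\<close> the components of \<open>\<xi>\<close> and of \<open>\<phi> E\<^sub>1\<close> are orthogonal, with square
  norms \<open>\<epsilon>\<^sub>1 q\<close> and \<open>- q\<close>. Two such vectors in a plane determine each other up to a sign \<open>\<sigma>\<close>: \<open>p\<^sub>2 = \<sigma> \<epsilon>\<^sub>3 x\<^sub>3\<close>
  and \<open>p\<^sub>3 = - \<sigma> \<epsilon>\<^sub>2 x\<^sub>2\<close> (lemma \<open>orthogonal_pair_in_plane\<close>). Since \<open>\<sigma>\<close> depends continuously on the
  parameter and the interval is connected, \<open>\<sigma>\<close> is constant. Hence \<open>\<alpha>\<close> and \<open>\<delta>\<close> are constant multiples
  of \<open>\<kappa> x\<^sub>2\<close> and \<open>\<kappa> x\<^sub>3\<close> along the curve. The curvature comes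
  from \<open>\<epsilon>\<^sub>2 x\<^sub>2\<^sup>2 + \<epsilon>\<^sub>3 x\<^sub>3\<^sup>2 = \<epsilon>\<^sub>1 q\<close>; in \<open>\<alpha> \<delta>' - \<alpha>' \<delta>\<close> the derivative of \<open>\<kappa>\<close> cancels, and the Wronskian of
  \<open>x\<^sub>2\<close> and \<open>x\<^sub>3\<close> that remains contains \<open>\<tau>\<close> (lemma \<open>slant_frenet_algebra\<close>).

  The formula for \<open>\<nabla> \<xi>\<close> is derived from normality by evaluating the normality tensor on \<open>(X, \<xi>)\<close>, where
  \<open>X\<close> is a local field of eigenvectors of \<open>\<phi>\<close>. This yields \<open>g(X, \<nabla>\<^sub>X \<xi>) = 0\<close> and
  \<open>g(X, \<nabla>\<^sub>\<xi> \<xi>) = 0\<close> (lemma \<open>eigenvector_D_xi\<close>). As the eigenvectors of \<open>\<phi>\<close> in \<open>ker \<eta>\<close> are null and \<open>ker \<eta>\<close> is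
  a plane, \<open>\<nabla> \<xi>\<close> is diagonal in the eigenframe of \<open>\<phi>\<close>, and its entries \<open>\<alpha> \<plusminus> \<beta>\<close> on \<open>ker \<eta>\<close> are
  read off from the traces that define \<open>\<alpha>\<close> and \<open>\<beta>\<close>.
\<close>

section \<open>Calculus of k times differentiable maps\<close>

lemma frechet_derivative_within_cong:
  assumes "\<And>y. y \<in> S \<Longrightarrow> f y = g y" and "x \<in> S"
  shows "frechet_derivative f (at x within S) = frechet_derivative g (at x within S)"
proof -
  have "(f has_derivative f') (at x within S) \<longleftrightarrow> (g has_derivative f') (at x within S)" for f'
    using assms by (metis has_derivative_transform)
  then show ?thesis by (simp add: frechet_derivative_def)
qed

lemma Ck_on_cong:
  assumes "\<And>y. y \<in> S \<Longrightarrow> f y = g y" and "Ck_on k f S"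
  shows "Ck_on k g S"
  using assms
proof (induction k arbitrary: f g)
  case 0
  then show ?case by (simp cong: continuous_on_cong)
next
  case (Suc k)
  have "g differentiable_on S"
    unfolding differentiable_on_def
  proof
    fix x assume x: "x \<in> S"
    then have "f differentiable (at x within S)"
      using Suc.prems(2) by (simp add: differentiable_on_def)
    then show "g differentiable (at x within S)"
      by (rule differentiable_transform_within[OF _ zero_less_one x]) (rule Suc.prems(1))
  qed
  moreover have "Ck_on k (\<lambda>x. frechet_derivative g (at x within S) v) S" for v
  proof (rule Suc.IH)
    show "Ck_on k (\<lambda>x. frechet_derivative f (at x within S) v) S"
      using Suc.prems(2) by simp
    show "frechet_derivative f (at y within S) v = frechet_derivative g (at y within S) v"
      if "y \<in> S" for y
      using frechet_derivative_within_cong[OF Suc.prems(1) that] by simp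
  qed
  ultimately show ?case by simp
qed

text \<open>
  On an open set the derivative within the set is the full derivative, and it is unique. This lemma
  and the next one turn the recursive definition into rules for an arbitrary derivative, from which
  each closure property follows by resolving with the matching differentiation rule.
\<close>

lemma Ck_on_SucI:
  assumes "open S" and f': "\<And>y. y \<in> S \<Longrightarrow> (f has_derivative f' y) (at y)"
    and smooth: "\<And>v. Ck_on k (\<lambda>y. f' y v) S"
  shows "Ck_on (Suc k) f S"
proof -
  have "f differentiable_on S"
    unfolding differentiable_on_def
  proof
    fix x assume "x \<in> S"
    from f'[OF this] show "f differentiable (at x within S)"
      unfolding at_within_open[OF \<open>x \<in> S\<close> \<open>open S\<close>] by (rule differentiableI)
  qed
  moreover have "Ck_on k (\<lambda>x. frechet_derivative f (at x within S) v) S" for v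
  proof (rule Ck_on_cong[OF _ smooth])
    show "f' y v = frechet_derivative f (at y within S) v" if "y \<in> S" for y
      unfolding at_within_open[OF that \<open>open S\<close>]
      by (rule fun_cong[OF frechet_derivative_at[OF f'[OF that]]])
  qed
  ultimately show ?thesis
    unfolding Ck_on.simps by blast
qed

lemma Ck_on_SucD:
  assumes "open S" "Ck_on (Suc k) f S"
  shows "y \<in> S \<Longrightarrow> (f has_derivative frechet_derivative f (at y)) (at y)"
    and "Ck_on k (\<lambda>y. frechet_derivative f (at y) v) S"
proof -
  show "(f has_derivative frechet_derivative f (at y)) (at y)" if "y \<in> S" for y
    using assms that unfolding Ck_on.simps differentiable_on_def
    by (metis at_within_open frechet_derivative_works)
  have "Ck_on k (\<lambda>x. frechet_derivative f (at x within S) v) S"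
    using assms(2) unfolding Ck_on.simps by blast
  then show "Ck_on k (\<lambda>y. frechet_derivative f (at y) v) S"
    by (rule Ck_on_cong[rotated]) (simp add: at_within_open[OF _ assms(1)])
qed

lemma Ck_on_less:
  assumes "open S" "Ck_on (Suc k) f S"
  shows "Ck_on k f S"
  using assms(2)
proof (induction k arbitrary: f)
  case 0
  then show ?case by (simp add: differentiable_imp_continuous_on)
next
  case (Suc k)
  show ?case
    by (rule Ck_on_SucI[OF assms(1) Ck_on_SucD(1)[OF assms(1) Suc.prems]
          Suc.IH[OF Ck_on_SucD(2)[OF assms(1) Suc.prems]]])
qed

lemma Ck_on_open_subset:
  assumes "open S" "open T" "T \<subseteq> S" "Ck_on k f S"
  shows "Ck_on k f T"
  using assms(4)
proof (induction k arbitrary: f)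
  case 0
  then show ?case using assms(3) by (auto intro: continuous_on_subset)
next
  case (Suc k)
  note f = Ck_on_SucD[OF assms(1) Suc.prems]
  show ?case
    by (rule Ck_on_SucI[OF assms(2) f(1) Suc.IH[OF f(2)]]) (use assms(3) in blast)
qed

lemma Ck_on_const: "open S \<Longrightarrow> Ck_on k (\<lambda>x. a) S"
proof (induction k arbitrary: a)
  case (Suc k)
  show ?case
    by (rule Ck_on_SucI[OF Suc.prems has_derivative_const Suc.IH[OF Suc.prems]])
qed simp

lemma Ck_on_add:
  assumes "open S" "Ck_on k f S" "Ck_on k h S"
  shows "Ck_on k (\<lambda>x. f x + h x) S"
  using assms(2,3)
proof (induction k arbitrary: f h)
  case 0
  then show ?case by (simp add: continuous_on_add)
next
  case (Suc k)
  note f = Ck_on_SucD[OF assms(1) Suc.prems(1)] and h = Ck_on_SucD[OF assms(1) Suc.prems(2)]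
  show ?case
    by (rule Ck_on_SucI[OF assms(1) has_derivative_add[OF f(1) h(1)] Suc.IH[OF f(2) h(2)]])
qed

lemma Ck_on_scaleR:
  fixes f :: "'a::real_normed_vector \<Rightarrow> real"
  assumes "open S" "Ck_on k f S" "Ck_on k h S"
  shows "Ck_on k (\<lambda>x. f x *\<^sub>R h x) S"
  using assms(2,3)
proof (induction k arbitrary: f h)
  case 0
  then show ?case by (simp add: continuous_on_scaleR)
next
  case (Suc k)
  note f = Ck_on_SucD[OF assms(1) Suc.prems(1)] Ck_on_less[OF assms(1) Suc.prems(1)]
  note h = Ck_on_SucD[OF assms(1) Suc.prems(2)] Ck_on_less[OF assms(1) Suc.prems(2)]
  show ?case
    by (rule Ck_on_SucI[OF assms(1) has_derivative_scaleR[OF f(1) h(1)]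
          Ck_on_add[OF assms(1) Suc.IH[OF f(3) h(2)] Suc.IH[OF f(2) h(3)]]])
qed

lemma Ck_on_sum:
  assumes "open S" "finite J" "\<And>i. i \<in> J \<Longrightarrow> Ck_on k (f i) S"
  shows "Ck_on k (\<lambda>x. \<Sum>i\<in>J. f i x) S"
  using assms(2,3)
proof (induction J rule: finite_induct)
  case empty
  show ?case using Ck_on_const[OF assms(1), of k 0] by simp
next
  case (insert i J)
  then show ?case using Ck_on_add[OF assms(1), of k "f i" "\<lambda>x. \<Sum>i\<in>J. f i x"] by simp
qed

lemma Ck_on_component:
  fixes f :: "'a::real_normed_vector \<Rightarrow> real^'n"
  assumes "open S" "Ck_on k f S"
  shows "Ck_on k (\<lambda>x. f x $ i) S"
  using assms(2)
proof (induction k arbitrary: f)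
  case 0
  then show ?case by (simp add: bounded_linear.continuous_on[OF bounded_linear_vec_nth])
next
  case (Suc k)
  note f = Ck_on_SucD[OF assms(1) Suc.prems]
  show ?case
    by (rule Ck_on_SucI[OF assms(1)
          bounded_linear.has_derivative[OF bounded_linear_vec_nth f(1)] Suc.IH[OF f(2)]])
qed

text \<open>
  The derivative of the outer map is only known to be smooth in each fixed direction, whereas the
  chain rule evaluates it in the varying direction \<open>D h(y) v\<close>; expanding that direction in the standard
  basis reduces the step to sums and products. This is why the intermediate space is \<open>real^'n\<close>.
\<close>

lemma Ck_on_compose:
  fixes h :: "'a::real_normed_vector \<Rightarrow> real^'n" and f :: "real^'n \<Rightarrow> 'b::real_normed_vector"
  assumes S: "open S" and T: "open T" and sub: "h ` S \<subseteq> T" and "Ck_on k f T" "Ck_on k h S"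
  shows "Ck_on k (\<lambda>x. f (h x)) S"
  using assms(4,5)
proof (induction k arbitrary: f)
  case 0
  then show ?case using sub by (auto intro: continuous_on_compose2)
next
  case (Suc k)
  note f = Ck_on_SucD[OF T Suc.prems(1)]
  note h = Ck_on_SucD[OF S Suc.prems(2)] Ck_on_less[OF S Suc.prems(2)]
  have der: "((\<lambda>x. f (h x)) has_derivative (\<lambda>v. \<Sum>i\<in>UNIV.
      (frechet_derivative h (at y) v $ i) *\<^sub>R frechet_derivative f (at (h y)) (axis i 1))) (at y)"
    if y: "y \<in> S" for y
  proof -
    have hy: "h y \<in> T" using y sub by auto
    have lin: "linear (frechet_derivative f (at (h y)))"
      using f(1)[OF hy] by (rule has_derivative_linear)
    have expand: "frechet_derivative f (at (h y)) w
        = (\<Sum>i\<in>UNIV. (w $ i) *\<^sub>R frechet_derivative f (at (h y)) (axis i 1))" for w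
    proof -
      have "frechet_derivative f (at (h y)) w
          = frechet_derivative f (at (h y)) (\<Sum>i\<in>UNIV. (w $ i) *\<^sub>R axis i 1)"
        by (simp add: scalar_mult_eq_scaleR[symmetric] basis_expansion)
      then show ?thesis by (simp add: linear_sum[OF lin] linear_scale[OF lin])
    qed
    show ?thesis
      by (rule has_derivative_eq_rhs[OF has_derivative_compose[OF h(1)[OF y] f(1)[OF hy]]])
        (rule ext, rule expand)
  qed
  show ?case
    by (rule Ck_on_SucI[OF S der Ck_on_sum[OF S finite Ck_on_scaleR[OF S
          Ck_on_component[OF S h(2)] Suc.IH[OF f(2) h(3)]]]])
qed

lemma smooth_on_imp_differentiable:
  assumes "smooth_on f S" "open S" "x \<in> S"
  shows "f differentiable (at x)"
proof -
  have "Ck_on (Suc 0) f S" using assms(1) unfolding smooth_on_def by blast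
  from Ck_on_SucD(1)[OF assms(2) this assms(3)] show ?thesis
    by (rule differentiableI)
qed

section \<open>Tangent vectors and vector fields on a 3-manifold\<close>

locale smooth_manifold3 =
  fixes A :: "'a::{t2_space, second_countable_topology} chart set"
  assumes atlas: "smooth_atlas A"
begin

lemma chart_homeo: "c \<in> A \<Longrightarrow>
    homeomorphism (chart_dom c) (coord c ` chart_dom c) (coord c) (param c)"
  and open_chart_dom: "c \<in> A \<Longrightarrow> open (chart_dom c)"
  and open_chart_image: "c \<in> A \<Longrightarrow> open (coord c ` chart_dom c)"
  using atlas by (auto simp: smooth_atlas_def)

lemma param_coord: "c \<in> A \<Longrightarrow> p \<in> chart_dom c \<Longrightarrow> param c (coord c p) = p"
  using chart_homeo by (auto simp: homeomorphism_def)

lemma open_coord_image: "c \<in> A \<Longrightarrow> open U \<Longrightarrow> open (coord c ` (chart_dom c \<inter> U))"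
  using homeomorphism_imp_open_map[OF chart_homeo, of c "chart_dom c \<inter> U"] open_chart_image
  by (meson openin_open_Int openin_open_trans)

lemma chart_at: "chart_at A p \<in> A" "p \<in> chart_dom (chart_at A p)"
proof -
  have "p \<in> (\<Union>c\<in>A. chart_dom c)"
    using atlas by (simp add: smooth_atlas_def)
  then have "\<exists>c. c \<in> A \<and> p \<in> chart_dom c"
    by blast
  from someI_ex[OF this] show "chart_at A p \<in> A" "p \<in> chart_dom (chart_at A p)"
    unfolding chart_at_def by auto
qed

lemma transition_smooth:
  "c \<in> A \<Longrightarrow> d \<in> A \<Longrightarrow> smooth_on (coord d \<circ> param c) (coord c ` (chart_dom c \<inter> chart_dom d))"
  using atlas by (auto simp: smooth_atlas_def)

lemma transition_differentiable:
  assumes "c \<in> A" "d \<in> A" "p \<in> chart_dom c" "p \<in> chart_dom d"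
  shows "(coord d \<circ> param c) differentiable (at (coord c p))"
  using assms by (intro smooth_on_imp_differentiable[OF transition_smooth open_coord_image])
    (auto simp: open_chart_dom)

text \<open>
  The cocycle identity of the transition maps, by the chain rule; it makes coordinate vectors define
  tangent vectors.
\<close>

lemma transition_derivative_compose:
  assumes c: "c \<in> A" "p \<in> chart_dom c" and d: "d \<in> A" "p \<in> chart_dom d"
    and e: "e \<in> A" "p \<in> chart_dom e"
  shows "frechet_derivative (coord e \<circ> param d) (at (coord d p))
           (frechet_derivative (coord d \<circ> param c) (at (coord c p)) w)
       = frechet_derivative (coord e \<circ> param c) (at (coord c p)) w"
proof -
  have "((coord e \<circ> param d) \<circ> (coord d \<circ> param c) has_derivative
      frechet_derivative (coord e \<circ> param d) (at (coord d p))
        \<circ> frechet_derivative (coord d \<circ> param c) (at (coord c p))) (at (coord c p))"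
    using assms by (intro diff_chain_at)
      (auto simp: frechet_derivative_works[symmetric] param_coord transition_differentiable)
  then have "((coord e \<circ> param c) has_derivative
      frechet_derivative (coord e \<circ> param d) (at (coord d p))
        \<circ> frechet_derivative (coord d \<circ> param c) (at (coord c p))) (at (coord c p))"
    by (rule has_derivative_transform_within_open[
          OF _ open_coord_image[OF c(1) open_chart_dom[OF d(1)]]])
      (use c d in \<open>auto simp: param_coord\<close>)
  from frechet_derivative_at[OF this] show ?thesis by (simp add: fun_eq_iff)
qed

lemma transition_derivative_id:
  assumes "c \<in> A" "p \<in> chart_dom c"
  shows "frechet_derivative (coord c \<circ> param c) (at (coord c p)) w = w"
proof -
  have "((\<lambda>z. z) has_derivative (\<lambda>z. z)) (at (coord c p))" by simp
  then have der: "((coord c \<circ> param c) has_derivative (\<lambda>z. z)) (at (coord c p))"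
    by (rule has_derivative_transform_within_open[OF _ open_chart_image[of c]])
       (use assms in \<open>auto simp: param_coord\<close>)
  show ?thesis
    unfolding frechet_derivative_at[OF der, symmetric] ..
qed

lemma coords_chart_vector:
  "d \<in> A \<Longrightarrow> p \<in> chart_dom d \<Longrightarrow> coords (chart_vector A c p w) d =
     frechet_derivative (coord d \<circ> param c) (at (coord c p)) w"
  by (simp add: chart_vector_def)

lemma coords_chart_vector_self [simp]:
  "c \<in> A \<Longrightarrow> p \<in> chart_dom c \<Longrightarrow> coords (chart_vector A c p w) c = w"
  by (simp add: coords_chart_vector transition_derivative_id)

text \<open>
  Together with \<open>chart_vector_coords\<close> this identifies each tangent space with \<open>real^3\<close> through any
  chart around the point.
\<close>

lemma chart_vector_tangent:
  assumes "c \<in> A" "p \<in> chart_dom c"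
  shows "chart_vector A c p w \<in> tangent_space A p"
  unfolding tangent_space_def
proof (intro CollectI ballI impI)
  fix d assume d: "d \<in> A" "p \<in> chart_dom d"
  show "chart_vector A c p w = chart_vector A d p (coords (chart_vector A c p w) d)"
    unfolding coords_chart_vector[OF d]
    by (rule tvec_eqI) (simp add: chart_vector_def transition_derivative_compose[OF assms d])
qed

lemma chart_vector_coords:
  "v \<in> tangent_space A p \<Longrightarrow> c \<in> A \<Longrightarrow> p \<in> chart_dom c \<Longrightarrow> chart_vector A c p (coords v c) = v"
  by (auto simp: tangent_space_def)

lemma linear_coords: "linear (\<lambda>v. coords v c)"
  by (rule linearI) (simp_all add: plus_tvec_def scaleR_tvec_def)

lemma linear_chart_vector:
  assumes "c \<in> A" "p \<in> chart_dom c"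
  shows "linear (chart_vector A c p)"
proof (rule linearI)
  have lin: "linear (frechet_derivative (coord d \<circ> param c) (at (coord c p)))"
    if "d \<in> A" "p \<in> chart_dom d" for d
    using transition_differentiable that assms by (intro linear_frechet_derivative)
  show "chart_vector A c p (u + v) = chart_vector A c p u + chart_vector A c p v" for u v
    by (rule tvec_eqI) (simp add: chart_vector_def plus_tvec_def linear_add[OF lin])
  show "chart_vector A c p (r *\<^sub>R u) = r *\<^sub>R chart_vector A c p u" for r u
    by (rule tvec_eqI) (simp add: chart_vector_def scaleR_tvec_def linear_scale[OF lin])
qed

lemma subspace_tangent: "subspace (tangent_space A p)"
proof -
  let ?c = "chart_at A p"
  have "tangent_space A p = range (chart_vector A ?c p)"
    using chart_vector_coords[OF _ chart_at] chart_vector_tangent[OF chart_at]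
    by (metis (no_types, lifting) rangeE rangeI subsetI subset_antisym)
  then show ?thesis
    using linear_chart_vector[OF chart_at] by (simp add: linear_subspace_image)
qed

lemmas tangent_closed =
  subspace_add[OF subspace_tangent] subspace_diff[OF subspace_tangent]
  subspace_scale[OF subspace_tangent] subspace_0[OF subspace_tangent]
  subspace_neg[OF subspace_tangent] subspace_sum[OF subspace_tangent]

text \<open>
  Three linearly independent tangent vectors. Independence is phrased with coefficient families, not
  as independence of a set, so that a frame is a family and no distinctness of its members has to be shown.
\<close>

definition tangent_frame :: "'a \<Rightarrow> (3 \<Rightarrow> 'a tvec) \<Rightarrow> bool" where
  "tangent_frame p b \<longleftrightarrow> (\<forall>i. b i \<in> tangent_space A p) \<and>
     (\<forall>x. (\<Sum>i\<in>UNIV. x i *\<^sub>R b i) = 0 \<longrightarrow> (\<forall>i. x i = 0))"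

text \<open>
  The matrix whose columns are the coordinate vectors of the frame; it is invertible because it has
  trivial kernel. It serves both to expand vectors in the frame and to conjugate an endomorphism into
  diagonal form.
\<close>

lemma frame_matrix:
  assumes frame: "tangent_frame p b" and c: "c \<in> A" "p \<in> chart_dom c"
  shows "\<exists>M. invertible M \<and> (\<forall>x. M *v x = (\<Sum>i\<in>UNIV. x $ i *\<^sub>R coords (b i) c))"
proof -
  have b: "b i \<in> tangent_space A p" for i
    using frame by (simp add: tangent_frame_def)
  have indep: "\<forall>i. x i = 0" if "(\<Sum>i\<in>UNIV. x i *\<^sub>R b i) = 0" for x
    using frame that by (simp add: tangent_frame_def)
  define M :: "real^3^3" where "M = (\<chi> i j. coords (b j) c $ i)"
  have mult: "M *v x = (\<Sum>i\<in>UNIV. x $ i *\<^sub>R coords (b i) c)" for x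
    by (simp add: M_def matrix_vector_mult_def vec_eq_iff mult.commute)
  have "x = 0" if "M *v x = 0" for x
  proof -
    have "(\<Sum>i\<in>UNIV. x $ i *\<^sub>R b i) = chart_vector A c p (M *v x)"
      by (simp add: mult linear_sum[OF linear_chart_vector[OF c]]
          linear_scale[OF linear_chart_vector[OF c]] chart_vector_coords[OF b c])
    also have "\<dots> = 0"
      using that by (simp add: linear_0[OF linear_chart_vector[OF c]])
    finally show "x = 0" using indep[of "\<lambda>i. x $ i"] by (simp add: vec_eq_iff)
  qed
  then have "invertible M"
    by (metis invertible_left_inverse matrix_left_invertible_ker)
  then show ?thesis using mult by blast
qed

lemma frame_expansion:
  assumes frame: "tangent_frame p b"
    and v: "v \<in> tangent_space A p"
  obtains x where "v = (\<Sum>i\<in>UNIV. x i *\<^sub>R b i)"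
proof -
  let ?c = "chart_at A p"
  have b: "b i \<in> tangent_space A p" for i
    using frame by (simp add: tangent_frame_def)
  obtain M where M: "invertible M" "\<And>x. M *v x = (\<Sum>i\<in>UNIV. x $ i *\<^sub>R coords (b i) ?c)"
    using frame_matrix[OF frame chart_at] by blast
  obtain x where "M *v x = coords v ?c"
    using M(1) by (metis invertible_def matrix_vector_mul_assoc matrix_vector_mul_lid)
  then have "v = chart_vector A ?c p (\<Sum>i\<in>UNIV. x $ i *\<^sub>R coords (b i) ?c)"
    by (metis M(2) chart_vector_coords[OF v chart_at])
  also have "\<dots> = (\<Sum>i\<in>UNIV. x $ i *\<^sub>R b i)"
    by (simp add: linear_sum[OF linear_chart_vector[OF chart_at]]
          linear_scale[OF linear_chart_vector[OF chart_at]] chart_vector_coords[OF b chart_at])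
  finally show thesis using that by blast
qed

lemma lin_on_add_diff:
  assumes "lin_on (tangent_space A p) f" "u \<in> tangent_space A p" "v \<in> tangent_space A p"
  shows "f (u + v) = f u + f v" "f (u - v) = f u - f v"
proof -
  have *: "f (a *\<^sub>R u + b *\<^sub>R v) = a *\<^sub>R f u + b *\<^sub>R f v" for a b
    using assms by (auto simp: lin_on_def)
  show "f (u + v) = f u + f v" using *[of 1 1] by simp
  show "f (u - v) = f u - f v" using *[of 1 "-1"] by simp
qed

lemma lin_on_scale_minus:
  assumes "lin_on (tangent_space A p) f" "u \<in> tangent_space A p"
  shows "f (r *\<^sub>R u) = r *\<^sub>R f u" "f (- u) = - f u"
proof -
  have *: "f (a *\<^sub>R u + b *\<^sub>R u) = a *\<^sub>R f u + b *\<^sub>R f u" for a b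
    using assms by (auto simp: lin_on_def)
  show "f (r *\<^sub>R u) = r *\<^sub>R f u" using *[of r 0] by simp
  show "f (- u) = - f u" using *[of "-1" 0] by simp
qed

lemma lin_on_zero:
  assumes "lin_on (tangent_space A p) f"
  shows "f 0 = 0"
  using lin_on_scale_minus(1)[OF assms tangent_closed(4), of 0] by simp

text \<open>
  The trace is defined through one arbitrarily chosen chart; conjugation by the frame matrix shows that
  the value is the sum of the eigenvalues whatever that chart is.
\<close>

lemma tangent_trace_eigenframe:
  assumes frame: "tangent_frame p b"
    and F: "lin_on (tangent_space A p) F" and eigen: "\<And>i. F (b i) = l i *\<^sub>R b i"
  shows "tangent_trace A p F = (\<Sum>i\<in>UNIV. l i)"
proof -
  let ?c = "chart_at A p"
  have b: "b i \<in> tangent_space A p" for i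
    using frame by (simp add: tangent_frame_def)
  note lcv = linear_chart_vector[OF chart_at] and cvt = chart_vector_tangent[OF chart_at]
  define f where "f w = coords (F (chart_vector A ?c p w)) ?c" for w
  have linf: "linear f"
    unfolding f_def
    by (rule linearI)
      (simp_all add: linear_add[OF lcv] linear_scale[OF lcv] lin_on_add_diff[OF F cvt cvt] lin_on_scale_minus[OF F cvt]
        linear_add[OF linear_coords] linear_scale[OF linear_coords])
  obtain M where inv: "invertible M" and M: "\<And>x. M *v x = (\<Sum>i\<in>UNIV. x $ i *\<^sub>R coords (b i) ?c)"
    using frame_matrix[OF frame chart_at] by blast
  define L :: "real^3^3" where "L = (\<chi> i j. if i = j then l i else 0)"
  have "matrix f ** M = M ** L"
  proof (rule matrix_eq[THEN iffD2], rule allI)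
    fix x :: "real^3"
    have Lx: "(L *v x) $ i = l i * x $ i" for i
      by (simp add: L_def matrix_vector_mult_def if_distrib if_distribR sum.delta' cong: if_cong)
    have "(matrix f ** M) *v x = f (M *v x)"
      by (simp add: matrix_vector_mul_assoc[symmetric] matrix_works linf)
    also have "\<dots> = (\<Sum>i\<in>UNIV. x $ i *\<^sub>R f (coords (b i) ?c))"
      by (simp add: M linear_sum[OF linf] linear_scale[OF linf])
    also have "\<dots> = (\<Sum>i\<in>UNIV. (x $ i * l i) *\<^sub>R coords (b i) ?c)"
      by (simp add: f_def chart_vector_coords[OF b chart_at] eigen linear_scale[OF linear_coords])
    also have "\<dots> = M *v (L *v x)"
      by (simp add: M Lx mult.commute)
    finally show "(matrix f ** M) *v x = (M ** L) *v x"
      by (simp add: matrix_vector_mul_assoc)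
  qed
  moreover obtain N where N: "M ** N = mat 1" "N ** M = mat 1"
    using inv by (auto simp: invertible_def)
  ultimately have "matrix f = M ** L ** N"
    by (metis matrix_mul_assoc matrix_mul_rid)
  then have "trace (matrix f) = trace (N ** (M ** L))"
    by (simp only: trace_mul_sym[of "M ** L" N])
  also have "\<dots> = trace L"
    by (simp add: matrix_mul_assoc N)
  also have "\<dots> = (\<Sum>i\<in>UNIV. l i)"
    by (simp add: trace_def L_def)
  finally show ?thesis
    by (simp add: tangent_trace_def f_def[abs_def])
qed

lemma vfield_onI:
  assumes "\<And>p. p \<in> U \<Longrightarrow> X p \<in> tangent_space A p"
    and "\<And>c k. c \<in> A \<Longrightarrow>
      Ck_on k (\<lambda>z. coords (X (param c z)) c) (coord c ` (chart_dom c \<inter> U))"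
  shows "vfield_on A U X"
  using assms unfolding vfield_on_def smooth_on_def by blast

lemma vfield_onD:
  assumes "vfield_on A U X"
  shows "p \<in> U \<Longrightarrow> X p \<in> tangent_space A p"
    and "c \<in> A \<Longrightarrow> Ck_on k (\<lambda>z. coords (X (param c z)) c) (coord c ` (chart_dom c \<inter> U))"
  using assms unfolding vfield_on_def smooth_on_def by blast+

lemma vfield_on_open_subset:
  assumes X: "vfield_on A V X" and "open U" "open V" "U \<subseteq> V"
  shows "vfield_on A U X"
proof (rule vfield_onI)
  fix c k assume c: "c \<in> A"
  show "Ck_on k (\<lambda>z. coords (X (param c z)) c) (coord c ` (chart_dom c \<inter> U))"
    by (rule Ck_on_open_subset[OF open_coord_image[OF c \<open>open V\<close>]
          open_coord_image[OF c \<open>open U\<close>] _ vfield_onD(2)[OF X c]]) (use \<open>U \<subseteq> V\<close> in blast)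
qed (use vfield_onD(1)[OF X] \<open>U \<subseteq> V\<close> in blast)

lemma vfield_on_cong:
  assumes X: "vfield_on A U X" and eq: "\<And>p. p \<in> U \<Longrightarrow> X p = Y p"
  shows "vfield_on A U Y"
proof (rule vfield_onI)
  show "Y p \<in> tangent_space A p" if "p \<in> U" for p
    using vfield_onD(1)[OF X that] eq[OF that] by simp
  fix c k assume c: "c \<in> A"
  show "Ck_on k (\<lambda>z. coords (Y (param c z)) c) (coord c ` (chart_dom c \<inter> U))"
  proof (rule Ck_on_cong[OF _ vfield_onD(2)[OF X c]])
    fix z assume "z \<in> coord c ` (chart_dom c \<inter> U)"
    then have "param c z \<in> U" using c by (auto simp: param_coord)
    then show "coords (X (param c z)) c = coords (Y (param c z)) c" using eq by metis
  qed
qed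

lemma vfield_on_linear_combination:
  assumes U: "open U" and X: "vfield_on A U X" and Y: "vfield_on A U Y"
  shows "vfield_on A U (\<lambda>p. r *\<^sub>R X p + s *\<^sub>R Y p)"
proof (rule vfield_onI)
  show "r *\<^sub>R X p + s *\<^sub>R Y p \<in> tangent_space A p" if "p \<in> U" for p
    using vfield_onD(1)[OF X that] vfield_onD(1)[OF Y that] by (simp add: tangent_closed)
  fix c k assume c: "c \<in> A"
  note S = open_coord_image[OF c U]
  show "Ck_on k (\<lambda>z. coords (r *\<^sub>R X (param c z) + s *\<^sub>R Y (param c z)) c)
      (coord c ` (chart_dom c \<inter> U))"
    unfolding linear_add[OF linear_coords] linear_scale[OF linear_coords]
    by (rule Ck_on_add[OF S Ck_on_scaleR[OF S Ck_on_const[OF S] vfield_onD(2)[OF X c]]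
          Ck_on_scaleR[OF S Ck_on_const[OF S] vfield_onD(2)[OF Y c]]])
qed

text \<open>
  The field with constant coordinates in one chart. Its coordinates in another chart are a directional
  derivative of one transition map composed with the inverse transition map, hence smooth.
\<close>

lemma vfield_on_chart_vector:
  assumes c: "c \<in> A"
  shows "vfield_on A (chart_dom c) (\<lambda>p. chart_vector A c p w)"
  unfolding vfield_on_def
proof (intro conjI ballI)
  show "chart_vector A c p w \<in> tangent_space A p" if "p \<in> chart_dom c" for p
    using chart_vector_tangent c that by blast
  fix d assume d: "d \<in> A"
  let ?S = "coord d ` (chart_dom d \<inter> chart_dom c)"
  let ?T = "coord c ` (chart_dom c \<inter> chart_dom d)"
  have S: "open ?S" and T: "open ?T"
    using c d by (simp_all add: open_coord_image open_chart_dom)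
  show "smooth_on (\<lambda>z. coords (chart_vector A c (param d z) w) d) ?S"
    unfolding smooth_on_def
  proof
    fix k
    have "Ck_on k (\<lambda>z. frechet_derivative (coord d \<circ> param c) (at z within ?T) w) ?T"
      using transition_smooth[OF c d, unfolded smooth_on_def, rule_format, of "Suc k"] by simp
    moreover have "Ck_on k (coord c \<circ> param d) ?S"
      using transition_smooth[OF d c] by (simp add: smooth_on_def)
    moreover have "(coord c \<circ> param d) ` ?S \<subseteq> ?T"
      using c d by (auto simp: param_coord)
    ultimately have "Ck_on k (\<lambda>z. frechet_derivative (coord d \<circ> param c)
         (at ((coord c \<circ> param d) z) within ?T) w) ?S"
      by (rule Ck_on_compose[OF S T, rotated 1])
    then show "Ck_on k (\<lambda>z. coords (chart_vector A c (param d z) w) d) ?S"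
    proof (rule Ck_on_cong[rotated])
      fix z assume "z \<in> ?S"
      then obtain q where q: "q \<in> chart_dom d" "q \<in> chart_dom c" and z: "z = coord d q"
        by auto
      have "param d z = q" using d q z by (simp add: param_coord)
      moreover have "coord c q \<in> ?T" using q by auto
      ultimately show "frechet_derivative (coord d \<circ> param c) (at ((coord c \<circ> param d) z) within ?T) w
          = coords (chart_vector A c (param d z) w) d"
        using coords_chart_vector[OF d q(1)] by (simp add: at_within_open[OF _ T])
    qed
  qed
qed

lemma vfield_coords_differentiable:
  assumes "vfield_on A U X" "open U" "p \<in> U" "c \<in> A" "p \<in> chart_dom c"
  shows "(\<lambda>z. coords (X (param c z)) c) differentiable (at (coord c p))"
  using assms by (intro smooth_on_imp_differentiable[OF _ open_coord_image[of c U]])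
    (auto simp: vfield_on_def)

lemma dir_deriv_locally_constant:
  assumes "open U" "p \<in> U" "\<And>q. q \<in> U \<Longrightarrow> f q = k"
  shows "dir_deriv A p v f = 0"
proof -
  let ?c = "chart_at A p"
  have "((\<lambda>z. k) has_derivative (\<lambda>z. 0)) (at (coord ?c p))" by simp
  then have der: "((f \<circ> param ?c) has_derivative (\<lambda>z. 0)) (at (coord ?c p))"
    by (rule has_derivative_transform_within_open[OF _ open_coord_image[OF chart_at(1) assms(1)]])
       (use assms chart_at in \<open>auto simp: param_coord\<close>)
  show ?thesis
    unfolding dir_deriv_def Let_def frechet_derivative_at[OF der, symmetric] ..
qed

lemma coord_field_vfield:
  "c \<in> A \<Longrightarrow> vfield_on A (chart_dom c) (coord_field A c i)"
  using vfield_on_chart_vector[of c "axis i 1"] by (simp add: coord_field_def[abs_def])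

lemma chart_vector_expansion:
  assumes "c \<in> A" "p \<in> chart_dom c"
  shows "chart_vector A c p w = (\<Sum>i\<in>UNIV. w $ i *\<^sub>R coord_field A c i p)"
proof -
  have "chart_vector A c p w = chart_vector A c p (\<Sum>i\<in>UNIV. w $ i *\<^sub>R axis i 1)"
    by (simp add: scalar_mult_eq_scaleR[symmetric] basis_expansion)
  then show ?thesis
    using assms
    by (simp add: coord_field_def linear_sum[OF linear_chart_vector]
        linear_scale[OF linear_chart_vector])
qed

end

section \<open>Pointwise algebra of an almost paracontact metric structure\<close>

locale almost_paracontact_metric3 = smooth_manifold3 A
  for A :: "'a::{t2_space, second_countable_topology} chart set" +
  fixes \<phi> :: "'a \<Rightarrow> 'a tvec \<Rightarrow> 'a tvec" and \<xi> :: "'a \<Rightarrow> 'a tvec"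
    and \<eta> :: "'a \<Rightarrow> 'a tvec \<Rightarrow> real" and g :: "'a \<Rightarrow> 'a tvec \<Rightarrow> 'a tvec \<Rightarrow> real"
  assumes metric_structure: "almost_paracontact_metric A \<phi> \<xi> \<eta> g"
begin

lemma almost_paracontact: "almost_paracontact A \<phi> \<xi> \<eta>"
  and metric: "pseudo_riemannian A 2 1 g"
  using metric_structure by (simp_all add: almost_paracontact_metric_def)

lemma g_compatible:
  "u \<in> tangent_space A p \<Longrightarrow> v \<in> tangent_space A p \<Longrightarrow>
    g p (\<phi> p u) (\<phi> p v) = - g p u v + \<eta> p u * \<eta> p v"
  using metric_structure by (simp add: almost_paracontact_metric_def)

lemma phi_field: "endo_field A \<phi>"
  and xi_field: "vfield_on A UNIV \<xi>"
  and eta_form: "one_form A \<eta>"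
  and eta_xi [simp]: "\<eta> p (\<xi> p) = 1"
  and phi_phi: "v \<in> tangent_space A p \<Longrightarrow> \<phi> p (\<phi> p v) = v - \<eta> p v *\<^sub>R \<xi> p"
  and dim_eigen: "dim {v \<in> tangent_space A p. \<eta> p v = 0 \<and> \<phi> p v = v} = 1"
    "dim {v \<in> tangent_space A p. \<eta> p v = 0 \<and> \<phi> p v = - v} = 1"
  using almost_paracontact unfolding almost_paracontact_def by blast+

lemma xi_tangent [simp]: "\<xi> p \<in> tangent_space A p"
  using vfield_onD(1)[OF xi_field] by simp

lemma phi_lin: "lin_on (tangent_space A p) (\<phi> p)"
  and phi_tangent [simp]: "v \<in> tangent_space A p \<Longrightarrow> \<phi> p v \<in> tangent_space A p"
  and phi_vfield: "open U \<Longrightarrow> vfield_on A U X \<Longrightarrow> vfield_on A U (\<lambda>q. \<phi> q (X q))"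
  using phi_field unfolding endo_field_def by blast+

lemma eta_lin: "lin_on (tangent_space A p) (\<eta> p)"
  using eta_form by (simp add: one_form_def)

lemma g_lin: "u \<in> tangent_space A p \<Longrightarrow> lin_on (tangent_space A p) (g p u)"
  and g_commute: "u \<in> tangent_space A p \<Longrightarrow> v \<in> tangent_space A p \<Longrightarrow> g p u v = g p v u"
  and g_signature: "has_signature (tangent_space A p) (g p) 2 1"
  using metric unfolding pseudo_riemannian_def by blast+

lemma tangent_0 [simp]: "0 \<in> tangent_space A p"
  by (rule tangent_closed)

lemmas phi_linear = lin_on_add_diff[OF phi_lin] lin_on_scale_minus[OF phi_lin]
lemmas phi_0 [simp] = lin_on_zero[OF phi_lin]
lemmas eta_linear = lin_on_add_diff[OF eta_lin] lin_on_scale_minus[OF eta_lin]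
lemmas eta_0 [simp] = lin_on_zero[OF eta_lin]
lemmas g_right_linear = lin_on_add_diff[OF g_lin] lin_on_scale_minus[OF g_lin]
lemmas g_0_right [simp] = lin_on_zero[OF g_lin]

lemma g_left_add_diff:
  assumes "w \<in> tangent_space A p" "u \<in> tangent_space A p" "v \<in> tangent_space A p"
  shows "g p (u + v) w = g p u w + g p v w" "g p (u - v) w = g p u w - g p v w"
  using assms by (simp_all add: g_commute[of _ p w] tangent_closed g_right_linear)

lemma g_left_scale_minus:
  assumes "w \<in> tangent_space A p" "u \<in> tangent_space A p"
  shows "g p (r *\<^sub>R u) w = r * g p u w" "g p (- u) w = - g p u w"
  using assms by (simp_all add: g_commute[of _ p w] tangent_closed g_right_linear)

lemmas g_left_linear = g_left_add_diff g_left_scale_minus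

text \<open>
  From \<open>\<phi>\<^sup>2 \<xi> = 0\<close>, applying \<open>\<phi>\<^sup>2 = id - \<eta> \<otimes> \<xi>\<close> to \<open>w = \<phi> \<xi>\<close> shows that \<open>w\<close> is a multiple of \<open>\<xi>\<close>; then
  \<open>\<phi> w = 0\<close> forces the factor or \<open>w\<close> itself to vanish.
\<close>

lemma phi_xi [simp]: "\<phi> p (\<xi> p) = 0"
proof -
  let ?w = "\<phi> p (\<xi> p)"
  have "\<phi> p ?w = 0" by (simp add: phi_phi)
  then have w: "?w = \<eta> p ?w *\<^sub>R \<xi> p"
    using phi_phi[of ?w p] by simp
  then have "0 = \<eta> p ?w *\<^sub>R ?w"
    using \<open>\<phi> p ?w = 0\<close> phi_linear(3)[of "\<xi> p" p "\<eta> p ?w"] by simp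
  then show ?thesis using w by (metis scaleR_eq_0_iff)
qed

text \<open>
  Compare the two ways of reducing \<open>\<phi>\<^sup>3 v\<close>: as \<open>\<phi>\<^sup>2\<close> of \<open>\<phi> v\<close>, and as \<open>\<phi>\<close> of \<open>\<phi>\<^sup>2 v\<close>.
\<close>

lemma eta_phi [simp]:
  assumes v: "v \<in> tangent_space A p"
  shows "\<eta> p (\<phi> p v) = 0"
proof -
  have "\<phi> p (v - \<eta> p v *\<^sub>R \<xi> p) = \<phi> p v"
    using v by (simp add: phi_linear tangent_closed)
  then have "\<eta> p (\<phi> p v) *\<^sub>R \<xi> p = 0"
    using v phi_phi[of "\<phi> p v" p] by (simp add: phi_phi)
  then show ?thesis by (metis eta_0 eta_xi scaleR_eq_0_iff zero_neq_one)
qed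

lemma g_xi [simp]: "v \<in> tangent_space A p \<Longrightarrow> g p v (\<xi> p) = \<eta> p v"
  using g_compatible[of v p "\<xi> p"] by simp

lemma g_xi_left [simp]: "v \<in> tangent_space A p \<Longrightarrow> g p (\<xi> p) v = \<eta> p v"
  by (simp add: g_commute)

lemma g_phi_skew:
  assumes "u \<in> tangent_space A p" "v \<in> tangent_space A p"
  shows "g p (\<phi> p u) v = - g p u (\<phi> p v)"
  using g_compatible[of u p "\<phi> p v"] assms
  by (simp add: phi_phi g_right_linear tangent_closed)

lemma g_phi_self [simp]: "v \<in> tangent_space A p \<Longrightarrow> g p v (\<phi> p v) = 0"
  using g_phi_skew[of v p v] g_commute[of v p "\<phi> p v"] by simp

lemma tangent_frame_orthogonal:
  assumes b: "\<And>i. b i \<in> tangent_space A p" and "\<And>i j. i \<noteq> j \<Longrightarrow> g p (b i) (b j) = 0"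
    and "\<And>i. g p (b i) (b i) \<noteq> 0"
  shows "tangent_frame p b"
  unfolding tangent_frame_def
proof (intro conjI allI impI b)
  fix x i assume x: "(\<Sum>i\<in>UNIV. x i *\<^sub>R b i) = 0"
  have sum: "g p (b i) (\<Sum>j\<in>UNIV. x j *\<^sub>R b j)
      = x 1 * g p (b i) (b 1) + x 2 * g p (b i) (b 2) + x 3 * g p (b i) (b 3)"
    by (simp add: sum_3 g_right_linear b tangent_closed)
  have "x i * g p (b i) (b i) = 0"
    using sum x b assms(2) exhaust_3[of i] by auto
  then show "x i = 0" using assms(3) by simp
qed

text \<open>
  The signature provides an orthonormal basis, and the coefficients of a vector in it are, up to sign,
  its scalar products with the basis.
\<close>

lemma g_nondegenerate:
  assumes u: "u \<in> tangent_space A p" and orth: "\<And>v. v \<in> tangent_space A p \<Longrightarrow> g p u v = 0"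
  shows "u = 0"
proof -
  have three: "(2::nat) + 1 = 3" by simp
  obtain e :: "nat \<Rightarrow> 'a tvec" where e: "\<And>i. i < 3 \<Longrightarrow> e i \<in> tangent_space A p"
    and ge: "\<And>i j. i < 3 \<Longrightarrow> j < 3 \<Longrightarrow>
      g p (e i) (e j) = (if i \<noteq> j then 0 else if i < 2 then 1 else -1)"
    using g_signature[of p] unfolding has_signature_def three by blast
  define b :: "3 \<Rightarrow> 'a tvec" where "b i = (if i = 1 then e 0 else if i = 2 then e 1 else e 2)" for i
  have b: "b i \<in> tangent_space A p" for i
    by (simp add: b_def e)
  have ne: "(1::3) \<noteq> 2" "(1::3) \<noteq> 3" "(2::3) \<noteq> 3" by simp_all
  have norm: "g p (b i) (b i) \<noteq> 0" for i
    by (simp add: b_def ge)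
  have off: "g p (b i) (b j) = 0" if "i \<noteq> j" for i j
    using that exhaust_3[of i] exhaust_3[of j] by (auto simp: b_def ge)
  have "tangent_frame p b"
    by (rule tangent_frame_orthogonal) (fact b off norm)+
  then obtain x where x: "u = (\<Sum>i\<in>UNIV. x i *\<^sub>R b i)"
    using frame_expansion[OF _ u] by blast
  have "g p u (b i) = x i * g p (b i) (b i)" for i
    using exhaust_3[of i] ne off unfolding x
    by (auto simp: sum_3 g_left_linear b tangent_closed)
  then have "x i = 0" for i using orth[OF b, of i] norm[of i] by simp
  then show ?thesis using x by simp
qed

lemma eigenvector:
  assumes "s = 1 \<or> s = -1"
  obtains u where "u \<in> tangent_space A p" "u \<noteq> 0" "\<eta> p u = 0" "\<phi> p u = s *\<^sub>R u"
proof -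
  let ?S = "{v \<in> tangent_space A p. \<eta> p v = 0 \<and> \<phi> p v = s *\<^sub>R v}"
  have "dim ?S = 1" using assms dim_eigen[of p] by auto
  have "\<not> ?S \<subseteq> {0}"
  proof
    assume "?S \<subseteq> {0}"
    then have "?S = {} \<or> ?S = {0}" by (rule subset_singletonD)
    then have "span {} = span ?S"
    proof
      assume "?S = {0}"
      show ?thesis unfolding \<open>?S = {0}\<close> by (rule span_insert_0[symmetric])
    next
      assume "?S = {}"
      show ?thesis unfolding \<open>?S = {}\<close> ..
    qed
    then have "dim ?S = 0" using dim_eq_card[of "{}" ?S] independent_empty by simp
    with \<open>dim ?S = 1\<close> show False by simp
  qed
  then show thesis using that by blast
qed

text \<open>
  On \<open>ker \<eta>\<close> the map \<open>\<phi>\<close> reverses the sign of \<open>g\<close>, while an eigenvalue \<open>\<plusminus> 1\<close> preserves it.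
\<close>

lemma eigenvector_null:
  assumes "u \<in> tangent_space A p" "\<eta> p u = 0" "\<phi> p u = s *\<^sub>R u" "s = 1 \<or> s = -1"
  shows "g p u u = 0"
  using g_compatible[of u p u] assms by (auto simp: g_left_linear g_right_linear tangent_closed)

lemma eigenframe:
  assumes u: "u \<in> tangent_space A p" "u \<noteq> 0" "\<eta> p u = 0" "\<phi> p u = u"
    and v: "v \<in> tangent_space A p" "v \<noteq> 0" "\<eta> p v = 0" "\<phi> p v = - v"
  shows "tangent_frame p (\<lambda>i. if i = 1 then \<xi> p else if i = 2 then u else v)"
  unfolding tangent_frame_def
proof (intro conjI allI impI)
  show "(if i = 1 then \<xi> p else if i = 2 then u else v) \<in> tangent_space A p" for i :: 3
    using u v by simp
  fix x :: "3 \<Rightarrow> real" and i :: 3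
  assume "(\<Sum>i\<in>UNIV. x i *\<^sub>R (if i = 1 then \<xi> p else if i = 2 then u else v)) = 0"
  then have *: "x 1 *\<^sub>R \<xi> p + x 2 *\<^sub>R u + x 3 *\<^sub>R v = 0"
    by (simp add: sum_3)
  have "\<eta> p (x 1 *\<^sub>R \<xi> p + x 2 *\<^sub>R u + x 3 *\<^sub>R v) = x 1"
    using u v by (simp add: eta_linear tangent_closed)
  then have x1: "x 1 = 0" using * by simp
  have "\<phi> p (x 1 *\<^sub>R \<xi> p + x 2 *\<^sub>R u + x 3 *\<^sub>R v) = x 2 *\<^sub>R u - x 3 *\<^sub>R v"
    using u v by (simp add: phi_linear tangent_closed)
  then have eq: "x 2 *\<^sub>R u = x 3 *\<^sub>R v" using * by simp
  have sum: "x 2 *\<^sub>R u + x 3 *\<^sub>R v = 0" using * x1 by simp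
  have "(2 * x 3) *\<^sub>R v = 0"
    using sum unfolding eq mult_2 scaleR_left_distrib .
  moreover have "(2 * x 2) *\<^sub>R u = 0"
    using sum unfolding eq[symmetric] mult_2 scaleR_left_distrib .
  ultimately have "x 2 = 0" "x 3 = 0" using u v by simp_all
  then show "x i = 0" using x1 exhaust_3[of i] by auto
qed

text \<open>
  An eigenvector extends to a local field of eigenvectors: extend it by constant coordinates to a field
  \<open>Y\<close> and apply the spectral projection \<open>(\<phi>\<^sup>2 + s \<phi>) / 2\<close>. Outside the chart \<open>Y\<close> is set to zero, so that the
  pointwise properties hold everywhere and \<open>\<phi> X\<close> and \<open>s X\<close> are equal as functions.
\<close>

lemma local_eigenfield:
  assumes u: "u \<in> tangent_space A p" "\<eta> p u = 0" "\<phi> p u = s *\<^sub>R u" and s: "s = 1 \<or> s = -1"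
  obtains U X where "open U" "p \<in> U" "vfield_on A U X" "X p = u"
    "\<And>q. X q \<in> tangent_space A q" "\<And>q. \<eta> q (X q) = 0" "\<And>q. \<phi> q (X q) = s *\<^sub>R X q"
proof -
  define c where "c = chart_at A p"
  have c: "c \<in> A" "p \<in> chart_dom c" using chart_at by (simp_all add: c_def)
  define U where "U = chart_dom c"
  have U: "open U" "p \<in> U" using c by (simp_all add: U_def open_chart_dom)
  define Y where "Y q = (if q \<in> U then chart_vector A c q (coords u c) else 0)" for q
  have "vfield_on A U (\<lambda>q. chart_vector A c q (coords u c))"
    unfolding U_def by (rule vfield_on_chart_vector[OF c(1)])
  then have Y: "vfield_on A U Y"
    by (rule vfield_on_cong) (simp add: Y_def)
  have YT [simp]: "Y q \<in> tangent_space A q" for q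
    using chart_vector_tangent[OF c(1)] by (simp add: Y_def U_def)
  have Yp: "Y p = u"
    using U chart_vector_coords[OF u(1) c] by (simp add: Y_def)
  define X where "X q = (1/2) *\<^sub>R \<phi> q (\<phi> q (Y q)) + (s/2) *\<^sub>R \<phi> q (Y q)" for q
  have ss: "s * s = 1" using s by auto
  show thesis
  proof (rule that[OF U])
    show "vfield_on A U X"
      unfolding X_def
      by (intro vfield_on_linear_combination phi_vfield U Y)
    show "X p = u"
      using u ss by (simp add: X_def Yp phi_linear flip: scaleR_left_distrib)
    show "X q \<in> tangent_space A q" for q
      by (simp add: X_def tangent_closed)
    show "\<eta> q (X q) = 0" for q
      by (simp add: X_def tangent_closed eta_linear)
    have "\<phi> q (\<phi> q (\<phi> q (Y q))) = \<phi> q (Y q)" for q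
      using phi_phi[of "\<phi> q (Y q)" q] by simp
    then show "\<phi> q (X q) = s *\<^sub>R X q" for q
      using ss by (simp add: X_def tangent_closed phi_linear scaleR_add_right)
  qed
qed

lemma g_combination:
  assumes "\<And>i. b i \<in> tangent_space A p" "w \<in> tangent_space A p"
  shows "g p (\<Sum>i\<in>UNIV. x (i::3) *\<^sub>R b i) w = (\<Sum>i\<in>UNIV. x i * g p (b i) w)"
  using assms by (simp add: sum_3 g_left_linear tangent_closed)

lemma orthonormal_expansion:
  assumes T: "u1 \<in> tangent_space A p" "u2 \<in> tangent_space A p" "u3 \<in> tangent_space A p"
    and norm: "g p u1 u1 = e1" "g p u2 u2 = e2" "g p u3 u3 = e3"
    and e: "e1 \<in> {1, -1}" "e2 \<in> {1, -1}" "e3 \<in> {1, -1::real}"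
    and orth: "g p u1 u2 = 0" "g p u1 u3 = 0" "g p u2 u3 = 0"
    and v: "v \<in> tangent_space A p"
  shows "v = (e1 * g p u1 v) *\<^sub>R u1 + (e2 * g p u2 v) *\<^sub>R u2 + (e3 * g p u3 v) *\<^sub>R u3"
proof -
  define b where "b i = (if i = (1::3) then u1 else if i = 2 then u2 else u3)" for i
  have orth': "g p u2 u1 = 0" "g p u3 u1 = 0" "g p u3 u2 = 0"
    using orth T by (simp_all add: g_commute[of _ p])
  have b: "b i \<in> tangent_space A p" for i using T by (simp add: b_def)
  have off: "g p (b i) (b j) = 0" if "i \<noteq> j" for i j
    using that exhaust_3[of i] exhaust_3[of j] orth orth' by (auto simp: b_def)
  have diag: "g p (b i) (b i) \<noteq> 0" for i using norm e by (auto simp: b_def)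
  have "tangent_frame p b"
    by (rule tangent_frame_orthogonal) (fact b off diag)+
  then obtain x where x: "v = (\<Sum>i\<in>UNIV. x i *\<^sub>R b i)"
    using frame_expansion[OF _ v] by blast
  then have x: "v = x 1 *\<^sub>R u1 + x 2 *\<^sub>R u2 + x 3 *\<^sub>R u3"
    by (simp add: sum_3 b_def)
  have "g p u1 v = e1 * x 1" "g p u2 v = e2 * x 2" "g p u3 v = e3 * x 3"
    unfolding x using T norm orth orth' by (simp_all add: g_right_linear tangent_closed)
  moreover have "e1 * e1 = 1" "e2 * e2 = 1" "e3 * e3 = 1" using e by auto
  ultimately show ?thesis using x by (simp flip: mult.assoc)
qed

text \<open>
  The Parseval identity of an indefinite orthonormal frame.
\<close>

lemma orthonormal_inner:
  assumes T: "u1 \<in> tangent_space A p" "u2 \<in> tangent_space A p" "u3 \<in> tangent_space A p"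
    and norm: "g p u1 u1 = e1" "g p u2 u2 = e2" "g p u3 u3 = e3"
    and e: "e1 \<in> {1, -1}" "e2 \<in> {1, -1}" "e3 \<in> {1, -1::real}"
    and orth: "g p u1 u2 = 0" "g p u1 u3 = 0" "g p u2 u3 = 0"
    and v: "v \<in> tangent_space A p" and w: "w \<in> tangent_space A p"
  shows "g p v w = e1 * g p u1 v * g p u1 w + e2 * g p u2 v * g p u2 w + e3 * g p u3 v * g p u3 w"
proof -
  have "g p v w = g p ((e1 * g p u1 v) *\<^sub>R u1 + (e2 * g p u2 v) *\<^sub>R u2 + (e3 * g p u3 v) *\<^sub>R u3) w"
    using orthonormal_expansion[OF T norm e orth v] by (rule arg_cong)
  then show ?thesis using T w by (simp add: g_left_linear tangent_closed)
qed

end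

section \<open>The covariant derivative of the characteristic field\<close>

locale normal_almost_paracontact_metric3 = almost_paracontact_metric3 A \<phi> \<xi> \<eta> g
  for A :: "'a::{t2_space, second_countable_topology} chart set" and \<phi> \<xi> \<eta> g +
  fixes D :: "'a connection"
  assumes connection: "levi_civita A g D" and normal: "normal_structure A \<phi> \<xi> \<eta>"
begin

lemma affine: "affine_connection A D"
  using connection by (simp add: levi_civita_def)

lemma D_tangent_lin:
  assumes "open U" "vfield_on A U Y" "p \<in> U"
  shows "(\<forall>v\<in>tangent_space A p. D p v Y \<in> tangent_space A p) \<and>
    lin_on (tangent_space A p) (\<lambda>v. D p v Y)"
  using affine[unfolded affine_connection_def, THEN spec, THEN spec, THEN mp, THEN mp,
      THEN conjunct1, THEN bspec, OF assms] .

lemmas D_tangent = D_tangent_lin[THEN conjunct1, THEN bspec]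
  and D_lin = D_tangent_lin[THEN conjunct2]

lemma torsion_free_metric:
  assumes "open U" "vfield_on A U X" "vfield_on A U Y" "p \<in> U"
  shows "D p (X p) Y - D p (Y p) X = lie_bracket A X Y p \<and>
    (\<forall>v\<in>tangent_space A p.
      dir_deriv A p v (\<lambda>q. g q (X q) (Y q)) = g p (D p v X) (Y p) + g p (X p) (D p v Y))"
  using connection[unfolded levi_civita_def, THEN conjunct2, THEN spec, THEN spec, THEN spec,
      THEN mp, THEN mp, THEN mp, THEN bspec, OF assms] .

lemmas torsion_free = torsion_free_metric[THEN conjunct1]
  and metric_compatible = torsion_free_metric[THEN conjunct2, THEN bspec]

lemma D_xi_tangent [simp]: "v \<in> tangent_space A p \<Longrightarrow> D p v \<xi> \<in> tangent_space A p"
  by (rule D_tangent[OF open_UNIV xi_field UNIV_I])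

lemmas D_xi_lin = D_lin[OF open_UNIV xi_field UNIV_I]
lemmas D_xi_linear = lin_on_add_diff[OF D_xi_lin] lin_on_scale_minus[OF D_xi_lin]

lemma lie_bracket_zero_right:
  assumes "open U" "vfield_on A U X" "p \<in> U"
  shows "lie_bracket A X (\<lambda>q. 0) p = 0"
proof (rule tvec_eqI)
  fix c
  have "frechet_derivative (\<lambda>z. coords (X (param c z)) c) (at (coord c p)) 0 = 0"
    if "c \<in> A" "p \<in> chart_dom c"
    using linear_0[OF linear_frechet_derivative[OF vfield_coords_differentiable[OF assms(2,1,3) that]]] .
  then show "coords (lie_bracket A X (\<lambda>q. 0) p) c = coords 0 c"
    by (simp add: lie_bracket_def zero_tvec_def frechet_derivative_const)
qed

lemma lie_bracket_scale_left:
  assumes "open U" "vfield_on A U X" "vfield_on A U Y" "p \<in> U"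
  shows "lie_bracket A (\<lambda>q. s *\<^sub>R X q) Y p = s *\<^sub>R lie_bracket A X Y p"
proof (rule tvec_eqI)
  fix c
  show "coords (lie_bracket A (\<lambda>q. s *\<^sub>R X q) Y p) c = coords (s *\<^sub>R lie_bracket A X Y p) c"
  proof (cases "c \<in> A \<and> p \<in> chart_dom c")
    case True
    then have c: "c \<in> A" "p \<in> chart_dom c" by simp_all
    let ?X = "\<lambda>z. coords (X (param c z)) c" and ?Y = "\<lambda>z. coords (Y (param c z)) c"
    have "(?X has_derivative frechet_derivative ?X (at (coord c p))) (at (coord c p))"
      using vfield_coords_differentiable[OF assms(2,1,4) c] by (simp add: frechet_derivative_works)
    then have "((\<lambda>z. s *\<^sub>R ?X z) has_derivative
        (\<lambda>w. s *\<^sub>R frechet_derivative ?X (at (coord c p)) w)) (at (coord c p))"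
      by (rule has_derivative_scaleR_right)
    from fun_cong[OF frechet_derivative_at[OF this], symmetric]
    have "frechet_derivative (\<lambda>z. s *\<^sub>R ?X z) (at (coord c p)) (coords (Y p) c)
        = s *\<^sub>R frechet_derivative ?X (at (coord c p)) (coords (Y p) c)" .
    moreover have "frechet_derivative ?Y (at (coord c p)) (s *\<^sub>R coords (X p) c)
        = s *\<^sub>R frechet_derivative ?Y (at (coord c p)) (coords (X p) c)"
      using linear_frechet_derivative[OF vfield_coords_differentiable[OF assms(3,1,4) c]]
      by (rule linear_scale)
    ultimately show ?thesis
      using c by (simp add: lie_bracket_def scaleR_tvec_def scaleR_diff_right)
  next
    case False
    then show ?thesis by (auto simp: lie_bracket_def scaleR_tvec_def)
  qed
qed

lemma D_xi_orthogonal_xi: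
  assumes "v \<in> tangent_space A p"
  shows "\<eta> p (D p v \<xi>) = 0"
proof -
  have "dir_deriv A p v (\<lambda>q. g q (\<xi> q) (\<xi> q)) = 0"
    by (rule dir_deriv_locally_constant[OF open_UNIV UNIV_I]) simp
  then show ?thesis
    using metric_compatible[OF open_UNIV xi_field xi_field UNIV_I assms] assms by simp
qed

text \<open>
  Let \<open>X\<close> be an eigenfield extending \<open>u\<close> and \<open>Z = [X, \<xi>] = \<nabla>\<^sub>u \<xi> - W\<close> with \<open>W = \<nabla>\<^sub>\<xi> X\<close>. Since \<open>\<eta>(X) = 0\<close> and
  \<open>\<eta>(\<xi>) = 1\<close>, \<open>2 d\<eta>(X, \<xi>) = - \<eta>(Z)\<close>, and with \<open>\<phi> X = s X\<close>, \<open>\<phi> \<xi> = 0\<close> normality becomes \<open>Z = s \<phi> Z\<close>. So \<open>Z\<close> is an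
  eigenvector for the same eigenvalue as \<open>u\<close>, which gives \<open>\<eta>(Z) = 0\<close> and \<open>g(u, Z) = 0\<close>. The field \<open>W\<close> is
  eliminated by differentiating \<open>g(X, X) = 0\<close> and \<open>g(X, \<xi>) = 0\<close> in the direction \<open>\<xi>\<close>.
\<close>

lemma eigenvector_D_xi:
  assumes u: "u \<in> tangent_space A p" "\<eta> p u = 0" "\<phi> p u = s *\<^sub>R u" and s: "s = 1 \<or> s = -1"
  shows "g p u (D p u \<xi>) = 0" and "g p u (D p (\<xi> p) \<xi>) = 0"
proof -
  obtain U X where U: "open U" "p \<in> U" and X: "vfield_on A U X" and Xp: "X p = u"
    and XT: "\<And>q. X q \<in> tangent_space A q" and eta_X: "\<And>q. \<eta> q (X q) = 0"
    and phi_X: "\<And>q. \<phi> q (X q) = s *\<^sub>R X q"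
    using local_eigenfield[OF u s] by blast
  have xi: "vfield_on A U \<xi>"
    by (rule vfield_on_open_subset[OF xi_field U(1) open_UNIV subset_UNIV])
  define W where "W = D p (\<xi> p) X"
  have W: "W \<in> tangent_space A p"
    unfolding W_def by (rule D_tangent[OF U(1) X U(2) xi_tangent])
  define Z where "Z = lie_bracket A X \<xi> p"
  have Z_eq: "Z = D p u \<xi> - W"
    using torsion_free[OF U(1) X xi U(2)] by (simp add: Z_def W_def Xp)
  have Z: "Z \<in> tangent_space A p"
    using u W by (simp add: Z_eq tangent_closed)

  have "dir_deriv A p (\<xi> p) (\<lambda>q. g q (X q) (X q)) = 0"
    using eigenvector_null[OF XT eta_X phi_X s]
    by (intro dir_deriv_locally_constant[OF U]) simp
  then have uW: "g p u W = 0"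
    using metric_compatible[OF U(1) X X U(2) xi_tangent] u(1) W
    by (simp add: W_def Xp g_commute[of _ p u])

  have "dir_deriv A p (\<xi> p) (\<lambda>q. g q (X q) (\<xi> q)) = 0"
    using XT eta_X by (intro dir_deriv_locally_constant[OF U]) simp
  then have xi_W: "\<eta> p W + g p u (D p (\<xi> p) \<xi>) = 0"
    using metric_compatible[OF U(1) X xi U(2) xi_tangent] W by (simp add: W_def Xp)

  have "dir_deriv A p (X p) (\<lambda>q. \<eta> q (\<xi> q)) = 0" "dir_deriv A p (\<xi> p) (\<lambda>q. \<eta> q (X q)) = 0"
    by (rule dir_deriv_locally_constant[OF U], simp add: eta_X)+
  then have d_eta: "2 * ext_deriv A \<eta> X \<xi> p = - \<eta> p Z"
    by (simp add: ext_deriv_def Z_def)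

  have "nijenhuis A \<phi> X \<xi> p - (2 * ext_deriv A \<eta> X \<xi> p) *\<^sub>R \<xi> p = 0"
    using normal[unfolded normal_structure_def, THEN spec, THEN spec, THEN spec,
        THEN mp, THEN mp, THEN mp, THEN bspec, OF U(1) X xi U(2)] .
  moreover have "nijenhuis A \<phi> X \<xi> p = \<phi> p (\<phi> p Z) - s *\<^sub>R \<phi> p Z"
    unfolding nijenhuis_def phi_X phi_xi lie_bracket_scale_left[OF U(1) X xi U(2)]
      lie_bracket_zero_right[OF U(1) X U(2)] Z_def[symmetric]
    using lie_bracket_zero_right[OF U(1) vfield_on_linear_combination[OF U(1) X X, of s 0] U(2)] Z
    by (simp add: phi_linear)
  ultimately have "Z = s *\<^sub>R \<phi> p Z"
    using Z by (simp add: phi_phi d_eta)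
  then have "\<eta> p Z = s * \<eta> p (\<phi> p Z)" and "g p u Z = s * g p u (\<phi> p Z)"
    using Z u by (metis eta_linear(3) phi_tangent real_scaleR_def, metis g_right_linear(3) phi_tangent real_scaleR_def)
  moreover have "g p u (\<phi> p Z) = - s * g p u Z"
    using g_phi_skew[OF u(1) Z] u Z by (simp add: g_left_linear)
  ultimately have eta_Z: "\<eta> p Z = 0" and "g p u Z = 0"
    using s Z by auto
  then show "g p u (D p u \<xi>) = 0"
    using uW u W by (simp add: Z_eq g_right_linear)
  show "g p u (D p (\<xi> p) \<xi>) = 0"
    using eta_Z xi_W u W by (simp add: Z_eq eta_linear D_xi_orthogonal_xi)
qed

text \<open>
  In the frame \<open>\<xi>\<close>, \<open>u\<close>, \<open>v\<close> of eigenvectors of \<open>\<phi>\<close> the null vectors \<open>u\<close> and \<open>v\<close> satisfy \<open>g(u, v) \<noteq> 0\<close>. Hence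
  \<open>g(u, \<nabla>\<^sub>u \<xi>) = 0\<close> kills the \<open>v\<close>-component of \<open>\<nabla>\<^sub>u \<xi>\<close>, its \<open>\<xi>\<close>-component vanishes because \<open>\<xi>\<close> has constant
  length, and symmetrically for \<open>v\<close>; so \<open>\<nabla> \<xi>\<close> is diagonal with entries \<open>0, k, l\<close>. The traces of \<open>\<nabla> \<xi>\<close> and of
  \<open>\<phi> \<circ> \<nabla> \<xi>\<close> are \<open>k + l\<close> and \<open>k - l\<close>.
\<close>

lemma D_xi:
  assumes w: "w \<in> tangent_space A p"
  shows "D p w \<xi> = assoc_alpha A D \<xi> p *\<^sub>R (w - \<eta> p w *\<^sub>R \<xi> p) + assoc_beta A D \<phi> \<xi> p *\<^sub>R \<phi> p w"
proof -
  obtain u where u: "u \<in> tangent_space A p" "u \<noteq> 0" "\<eta> p u = 0" "\<phi> p u = 1 *\<^sub>R u"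
    using eigenvector[of 1] by blast
  obtain v where v: "v \<in> tangent_space A p" "v \<noteq> 0" "\<eta> p v = 0" "\<phi> p v = (-1) *\<^sub>R v"
    using eigenvector[of "-1"] by blast
  have phi_u: "\<phi> p u = u" and phi_v: "\<phi> p v = - v" using u v by simp_all
  define b where "b = (\<lambda>i::3. if i = 1 then \<xi> p else if i = 2 then u else v)"
  have frame: "tangent_frame p b"
    unfolding b_def by (rule eigenframe[OF u(1-3) phi_u v(1-3) phi_v])
  have expand: "\<exists>x y z. r = x *\<^sub>R \<xi> p + y *\<^sub>R u + z *\<^sub>R v"
    if r: "r \<in> tangent_space A p" for r
  proof -
    obtain x where "r = (\<Sum>i\<in>UNIV. x i *\<^sub>R b i)"
      using frame_expansion[OF frame r] by blast
    then have "r = x 1 *\<^sub>R \<xi> p + x 2 *\<^sub>R u + x 3 *\<^sub>R v"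
      by (simp add: sum_3 b_def)
    then show ?thesis by blast
  qed
  have orth: "r = 0" if r: "r \<in> tangent_space A p" and "\<eta> p r = 0" "g p u r = 0" "g p v r = 0" for r
  proof (rule g_nondegenerate[OF r])
    fix t assume "t \<in> tangent_space A p"
    from expand[OF this] obtain x y z where "t = x *\<^sub>R \<xi> p + y *\<^sub>R u + z *\<^sub>R v" by blast
    then show "g p r t = 0"
      using that u v by (simp add: g_right_linear tangent_closed g_commute[of r])
  qed
  have uu: "g p u u = 0" and vv: "g p v v = 0"
    using eigenvector_null[OF u(1,3,4)] eigenvector_null[OF v(1,3,4)] by simp_all
  have uv: "g p u v \<noteq> 0"
    using orth[OF u(1,3) uu] u v by (auto simp: g_commute[of v p u])
  have Lxi: "D p (\<xi> p) \<xi> = 0"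
    using eigenvector_D_xi(2)[OF u(1,3,4)] eigenvector_D_xi(2)[OF v(1,3,4)]
    by (intro orth) (simp_all add: D_xi_orthogonal_xi)
  obtain k where Lu: "D p u \<xi> = k *\<^sub>R u"
  proof -
    obtain x y z where *: "D p u \<xi> = x *\<^sub>R \<xi> p + y *\<^sub>R u + z *\<^sub>R v"
      using expand[OF D_xi_tangent[OF u(1)]] by blast
    have "\<eta> p (D p u \<xi>) = x"
      unfolding * using u v by (simp add: eta_linear tangent_closed)
    then have "x = 0" by (simp add: D_xi_orthogonal_xi u)
    have "g p u (D p u \<xi>) = z * g p u v"
      unfolding * using u v uu by (simp add: g_right_linear tangent_closed)
    then have "z = 0" using eigenvector_D_xi(1)[OF u(1,3,4)] uv by simp
    with * \<open>x = 0\<close> show thesis using that[of y] by simp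
  qed
  obtain l where Lv: "D p v \<xi> = l *\<^sub>R v"
  proof -
    obtain x y z where *: "D p v \<xi> = x *\<^sub>R \<xi> p + y *\<^sub>R u + z *\<^sub>R v"
      using expand[OF D_xi_tangent[OF v(1)]] by blast
    have "\<eta> p (D p v \<xi>) = x"
      unfolding * using u v by (simp add: eta_linear tangent_closed)
    then have "x = 0" by (simp add: D_xi_orthogonal_xi v)
    have "g p v (D p v \<xi>) = y * g p u v"
      unfolding * using u v vv by (simp add: g_right_linear tangent_closed g_commute[of v p u])
    then have "y = 0" using eigenvector_D_xi(1)[OF v(1,3,4)] uv by simp
    with * \<open>x = 0\<close> show thesis using that[of z] by simp
  qed
  have "tangent_trace A p (\<lambda>v. D p v \<xi>) = (\<Sum>i\<in>UNIV. if i = (1::3) then 0 else if i = 2 then k else l)"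
    by (rule tangent_trace_eigenframe[OF frame D_xi_lin]) (simp add: b_def Lxi Lu Lv)
  then have alpha: "2 * assoc_alpha A D \<xi> p = k + l"
    by (simp add: assoc_alpha_def sum_3)
  have lin: "lin_on (tangent_space A p) (\<lambda>v. \<phi> p (D p v \<xi>))"
    unfolding lin_on_def by (simp add: D_xi_linear phi_linear tangent_closed)
  have "tangent_trace A p (\<lambda>v. \<phi> p (D p v \<xi>))
      = (\<Sum>i\<in>UNIV. if i = (1::3) then 0 else if i = 2 then k else - l)"
    by (rule tangent_trace_eigenframe[OF frame lin])
      (simp add: b_def Lxi Lu Lv u v phi_linear phi_u phi_v)
  then have beta: "2 * assoc_beta A D \<phi> \<xi> p = k - l"
    by (simp add: assoc_beta_def sum_3)
  have k: "k = assoc_alpha A D \<xi> p + assoc_beta A D \<phi> \<xi> p"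
    and l: "l = assoc_alpha A D \<xi> p - assoc_beta A D \<phi> \<xi> p"
    using alpha beta by linarith+
  obtain x y z where *: "w = x *\<^sub>R \<xi> p + y *\<^sub>R u + z *\<^sub>R v"
    using expand[OF w] by blast
  have Dw: "D p w \<xi> = y *\<^sub>R k *\<^sub>R u + z *\<^sub>R l *\<^sub>R v"
    unfolding * using u v by (simp add: D_xi_linear tangent_closed Lxi Lu Lv)
  have proj: "w - \<eta> p w *\<^sub>R \<xi> p = y *\<^sub>R u + z *\<^sub>R v"
    unfolding * using u v by (simp add: eta_linear tangent_closed)
  have phi_w: "\<phi> p w = y *\<^sub>R u - z *\<^sub>R v"
    unfolding * using u v by (simp add: phi_linear tangent_closed)
  show ?thesis
    unfolding Dw proj phi_w k l by (simp add: algebra_simps)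
qed

end

section \<open>Vector fields along a curve\<close>

lemma nondegenerate_interval_nontrivial_limit:
  assumes "nondegenerate_interval I" "t \<in> I"
  shows "at t within I \<noteq> bot"
proof -
  have "connected I" "\<nexists>a. I = {a}"
    using assms(1) by (auto simp: nondegenerate_interval_def is_interval_connected)
  then have "t islimpt I" using connected_imp_perfect assms(2) by blast
  then show ?thesis by (simp add: trivial_limit_within)
qed

locale smooth_curve3 = smooth_manifold3 A
  for A :: "'a::{t2_space, second_countable_topology} chart set" +
  fixes I :: "real set" and \<gamma> :: "real \<Rightarrow> 'a"
  assumes interval: "nondegenerate_interval I" and curve: "smooth_curve A I \<gamma>"
begin

lemmas nontrivial_limit = nondegenerate_interval_nontrivial_limit[OF interval]

text \<open>
  Smoothness along the curve is given chart by chart, on relatively open parts of the interval;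
  derivatives are taken within the whole interval. At a parameter in the part both filters agree.
\<close>

lemma at_within_preimage:
  assumes "t \<in> I" "open U" "\<gamma> t \<in> U"
  shows "at t within {s \<in> I. \<gamma> s \<in> U} = at t within I"
proof -
  have "continuous_on I \<gamma>" using curve by (simp add: smooth_curve_def)
  then have "openin (top_of_set I) (I \<inter> \<gamma> -` U)"
    using assms(2) by (rule continuous_openin_preimage_gen)
  then obtain T where T: "open T" "I \<inter> \<gamma> -` U = I \<inter> T"
    unfolding openin_open by blast
  then have "t \<in> T" using assms by blast
  show ?thesis
    by (rule at_within_nhd[OF \<open>t \<in> T\<close> T(1)]) (use T(2) in blast)
qed

lemma smooth_on_preimage_differentiable:
  assumes "smooth_on f {s \<in> I. \<gamma> s \<in> U}" "t \<in> I" "open U" "\<gamma> t \<in> U"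
  shows "f differentiable (at t within I)"
proof -
  have "Ck_on (Suc 0) f {s \<in> I. \<gamma> s \<in> U}"
    using assms(1) unfolding smooth_on_def by blast
  then have "f differentiable (at t within {s \<in> I. \<gamma> s \<in> U})"
    using assms unfolding Ck_on.simps differentiable_on_def by blast
  then show ?thesis by (simp only: at_within_preimage[OF assms(2-4)])
qed

lemma has_derivative_transform_preimage:
  assumes "(f has_derivative f') (at t within I)" "t \<in> I" "open U" "\<gamma> t \<in> U"
    and eq: "\<And>s. s \<in> I \<Longrightarrow> \<gamma> s \<in> U \<Longrightarrow> h s = f s"
  shows "(h has_derivative f') (at t within I)"
proof -
  have "(f has_derivative f') (at t within {s \<in> I. \<gamma> s \<in> U})"
    using assms(1) by (simp only: at_within_preimage[OF assms(2-4)])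
  then have "(h has_derivative f') (at t within {s \<in> I. \<gamma> s \<in> U})"
    by (rule has_derivative_transform[rotated 2]) (use assms in auto)
  then show ?thesis by (simp only: at_within_preimage[OF assms(2-4)])
qed

lemma velocity_coords:
  assumes "t \<in> I" "c \<in> A" "\<gamma> t \<in> chart_dom c"
  shows "((coord c \<circ> \<gamma>) has_vector_derivative coords (velocity A I \<gamma> t) c) (at t within I)"
proof -
  have "smooth_on (coord c \<circ> \<gamma>) {s \<in> I. \<gamma> s \<in> chart_dom c}"
    using curve assms(2) by (simp add: smooth_curve_def)
  then have "(coord c \<circ> \<gamma>) differentiable (at t within I)"
    using assms open_chart_dom by (intro smooth_on_preimage_differentiable)
  then show ?thesis
    using assms by (simp add: velocity_def vector_derivative_works)
qed

lemma transition_along: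
  assumes t: "t \<in> I" and c: "c \<in> A" "\<gamma> t \<in> chart_dom c"
    and U: "open U" "\<gamma> t \<in> U" and f: "(f \<circ> param c) differentiable (at (coord c (\<gamma> t)))"
  shows "((\<lambda>s. f (\<gamma> s)) has_vector_derivative
    frechet_derivative (f \<circ> param c) (at (coord c (\<gamma> t))) (coords (velocity A I \<gamma> t) c)) (at t within I)"
proof -
  let ?F = "frechet_derivative (f \<circ> param c) (at (coord c (\<gamma> t)))"
  have F: "((f \<circ> param c) has_derivative ?F) (at ((coord c \<circ> \<gamma>) t))"
    using f by (simp add: frechet_derivative_works)
  have "((\<lambda>s. (f \<circ> param c) ((coord c \<circ> \<gamma>) s)) has_derivative
      (\<lambda>r. ?F (r *\<^sub>R coords (velocity A I \<gamma> t) c))) (at t within I)"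
    by (rule has_derivative_compose[OF velocity_coords[OF t c, unfolded has_vector_derivative_def] F])
  then have "((\<lambda>s. f (\<gamma> s)) has_derivative
      (\<lambda>r. ?F (r *\<^sub>R coords (velocity A I \<gamma> t) c))) (at t within I)"
    by (rule has_derivative_transform_preimage[OF _ t open_chart_dom[OF c(1)] c(2)])
      (simp add: param_coord c)
  then show ?thesis
    by (simp add: has_vector_derivative_def linear_scale[OF has_derivative_linear[OF F]])
qed

lemma velocity_tangent:
  assumes t: "t \<in> I"
  shows "velocity A I \<gamma> t \<in> tangent_space A (\<gamma> t)"
  unfolding tangent_space_def
proof (intro CollectI ballI impI tvec_eqI)
  fix c d assume c: "c \<in> A" "\<gamma> t \<in> chart_dom c"
  show "coords (velocity A I \<gamma> t) d
      = coords (chart_vector A c (\<gamma> t) (coords (velocity A I \<gamma> t) c)) d"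
  proof (cases "d \<in> A \<and> \<gamma> t \<in> chart_dom d")
    case True
    then have d: "d \<in> A" "\<gamma> t \<in> chart_dom d" by simp_all
    have "((coord d \<circ> \<gamma>) has_vector_derivative
        frechet_derivative (coord d \<circ> param c) (at (coord c (\<gamma> t))) (coords (velocity A I \<gamma> t) c))
        (at t within I)"
      using transition_along[OF t c open_chart_dom[OF d(1)] d(2) transition_differentiable[OF c(1) d(1) c(2) d(2)]]
      by (simp add: comp_def)
    from vector_derivative_unique_within[OF nontrivial_limit[OF t] velocity_coords[OF t d] this]
    show ?thesis by (simp only: coords_chart_vector[OF d])
  next
    case False
    then show ?thesis by (auto simp: velocity_def chart_vector_def)
  qed
qed

text \<open>
  Smoothness of the coordinate curve makes its Frechet derivative differentiable; uniqueness of
  derivatives within the interval identifies that derivative with the velocity at all nearby parameters.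
\<close>

lemma velocity_coords_differentiable:
  assumes "t \<in> I" "c \<in> A" "\<gamma> t \<in> chart_dom c"
  shows "(\<lambda>s. coords (velocity A I \<gamma> s) c) differentiable (at t within I)"
proof -
  let ?J = "{s \<in> I. \<gamma> s \<in> chart_dom c}" and ?f = "coord c \<circ> \<gamma>"
  have "Ck_on (Suc (Suc 0)) ?f ?J"
    using curve assms(2) unfolding smooth_curve_def smooth_on_def by blast
  then have diff: "?f differentiable_on ?J"
    and "(\<lambda>s. frechet_derivative ?f (at s within ?J) 1) differentiable_on ?J"
    unfolding Ck_on.simps by blast+
  then have "(\<lambda>s. frechet_derivative ?f (at s within ?J) 1) differentiable (at t within ?J)"
    using assms unfolding differentiable_on_def by blast
  then obtain F where
    F: "((\<lambda>s. frechet_derivative ?f (at s within ?J) 1) has_derivative F) (at t within I)"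
    unfolding at_within_preimage[OF assms(1) open_chart_dom[OF assms(2)] assms(3)] differentiable_def
    by blast
  have "coords (velocity A I \<gamma> s) c = frechet_derivative ?f (at s within ?J) 1"
    if s: "s \<in> I" "\<gamma> s \<in> chart_dom c" for s
  proof -
    let ?F = "frechet_derivative ?f (at s within ?J)"
    have "?f differentiable (at s within ?J)"
      using diff s unfolding differentiable_on_def by blast
    then have der: "(?f has_derivative ?F) (at s within I)"
      unfolding frechet_derivative_works
        at_within_preimage[OF s(1) open_chart_dom[OF assms(2)] s(2)] .
    have "?F r = r *\<^sub>R ?F 1" for r
      using linear_scale[OF has_derivative_linear[OF der], of r 1] by simp
    then have "(?f has_vector_derivative ?F 1) (at s within I)"
      unfolding has_vector_derivative_def by (intro has_derivative_eq_rhs[OF der] ext)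
    from vector_derivative_unique_within[OF nontrivial_limit[OF s(1)]
        velocity_coords[OF s(1) assms(2) s(2)] this]
    show ?thesis .
  qed
  then have "((\<lambda>s. coords (velocity A I \<gamma> s) c) has_derivative F) (at t within I)"
    by (rule has_derivative_transform_preimage[OF F assms(1) open_chart_dom[OF assms(2)] assms(3)])
  then show ?thesis by (rule differentiableI)
qed

lemma smooth_fun_along:
  assumes t: "t \<in> I" and U: "open U" "\<gamma> t \<in> U" and f: "smooth_fun_on A U f"
  shows "((\<lambda>s. f (\<gamma> s)) has_real_derivative dir_deriv A (\<gamma> t) (velocity A I \<gamma> t) f) (at t within I)"
proof -
  let ?c = "chart_at A (\<gamma> t)"
  have "(f \<circ> param ?c) differentiable (at (coord ?c (\<gamma> t)))"
    using f chart_at U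
    by (intro smooth_on_imp_differentiable[OF _ open_coord_image[of ?c U]])
      (auto simp: smooth_fun_on_def)
  from transition_along[OF t chart_at U this] show ?thesis
    by (simp add: dir_deriv_def Let_def has_real_derivative_iff_has_vector_derivative)
qed

text \<open>
  Differentiability at \<open>t\<close> is tested in the chart through which the covariant derivative at \<open>t\<close> is defined.
\<close>

definition differentiable_along :: "(real \<Rightarrow> 'a tvec) \<Rightarrow> real \<Rightarrow> bool" where
  "differentiable_along V t \<longleftrightarrow> (\<forall>s\<in>I. V s \<in> tangent_space A (\<gamma> s)) \<and>
     (\<lambda>s. coords (V s) (chart_at A (\<gamma> t))) differentiable (at t within I)"

lemma differentiable_along_velocity:
  "t \<in> I \<Longrightarrow> differentiable_along (velocity A I \<gamma>) t"
  unfolding differentiable_along_def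
  using velocity_tangent velocity_coords_differentiable[OF _ chart_at] by blast

lemma differentiable_along_vfield:
  assumes "vfield_along A I \<gamma> V" "t \<in> I"
  shows "differentiable_along V t"
  unfolding differentiable_along_def
proof
  show "\<forall>s\<in>I. V s \<in> tangent_space A (\<gamma> s)"
    using assms(1) by (simp add: vfield_along_def)
  have "smooth_on (\<lambda>s. coords (V s) (chart_at A (\<gamma> t))) {s \<in> I. \<gamma> s \<in> chart_dom (chart_at A (\<gamma> t))}"
    using assms(1) chart_at(1) by (simp add: vfield_along_def)
  then show "(\<lambda>s. coords (V s) (chart_at A (\<gamma> t))) differentiable (at t within I)"
    by (rule smooth_on_preimage_differentiable[OF _ assms(2) open_chart_dom[OF chart_at(1)] chart_at(2)])
qed

lemma vector_derivative_along:
  assumes "(h has_vector_derivative h') (at t within I)" "t \<in> I" "\<And>s. s \<in> I \<Longrightarrow> f s = h s"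
  shows "vector_derivative f (at t within I) = h'"
proof -
  have "(f has_vector_derivative h') (at t within I)"
    using assms unfolding has_vector_derivative_def
    by (intro has_derivative_transform[OF assms(2,3)])
  then show ?thesis by (rule vector_derivative_within[OF nontrivial_limit[OF assms(2)]])
qed

lemma derivative_of_constant_along:
  assumes "(f has_real_derivative f') (at t within I)" "t \<in> I" "\<And>s. s \<in> I \<Longrightarrow> f s = k"
  shows "f' = 0"
proof -
  have "vector_derivative f (at t within I) = 0"
    by (rule vector_derivative_along[OF has_vector_derivative_const assms(2,3)])
  moreover have "vector_derivative f (at t within I) = f'"
    using assms(1) unfolding has_real_derivative_iff_has_vector_derivative
    by (rule vector_derivative_within[OF nontrivial_limit[OF assms(2)]])
  ultimately show ?thesis by simp
qed

end

section \<open>The product rule along a curve\<close>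

locale normal_almost_paracontact_curve3 =
  normal_almost_paracontact_metric3 A \<phi> \<xi> \<eta> g D + smooth_curve3 A I \<gamma>
  for A :: "'a::{t2_space, second_countable_topology} chart set" and \<phi> \<xi> \<eta> g D I \<gamma>
begin

text \<open>
  The product rule pairs a field along the curve with a field on an open set of the manifold. Expand \<open>V\<close> in
  the coordinate fields of the chart in which its covariant derivative is defined; each \<open>g(\<partial>\<^sub>i, Y)\<close> is a
  function on the manifold, to which metric compatibility of the connection applies.
\<close>

lemma derivative_g_along:
  assumes t: "t \<in> I" and V: "differentiable_along V t"
    and U: "open U" "\<gamma> t \<in> U" and Y: "vfield_on A U Y"
  shows "((\<lambda>s. g (\<gamma> s) (V s) (Y (\<gamma> s))) has_real_derivative
      g (\<gamma> t) (cov_deriv A D I \<gamma> V t) (Y (\<gamma> t))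
      + g (\<gamma> t) (V t) (D (\<gamma> t) (velocity A I \<gamma> t) Y)) (at t within I)"
proof -
  define p where "p = \<gamma> t"
  define c where "c = chart_at A p"
  have c: "c \<in> A" "p \<in> chart_dom c" using chart_at by (simp_all add: c_def)
  define N where "N = U \<inter> chart_dom c"
  have N: "open N" "p \<in> N" "\<gamma> t \<in> N"
    using U c open_chart_dom[OF c(1)] by (simp_all add: N_def p_def open_Int)
  let ?b = "coord_field A c" and ?v = "velocity A I \<gamma> t"
  have v: "?v \<in> tangent_space A p" using velocity_tangent[OF t] by (simp add: p_def)
  have b: "vfield_on A N (?b i)" for i
    by (rule vfield_on_open_subset[OF coord_field_vfield[OF c(1)] N(1) open_chart_dom[OF c(1)]])
      (simp add: N_def)
  have YO: "vfield_on A N Y"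
    by (rule vfield_on_open_subset[OF Y N(1) U(1)]) (simp add: N_def)
  have bT: "?b i q \<in> tangent_space A q" and YT: "Y q \<in> tangent_space A q" if "q \<in> N" for i q
    using vfield_onD(1)[OF b that] vfield_onD(1)[OF YO that] by auto
  define h where "h i q = g q (?b i q) (Y q)" for i q
  have h: "((\<lambda>s. h i (\<gamma> s)) has_real_derivative
      g p (D p ?v (?b i)) (Y p) + g p (?b i p) (D p ?v Y)) (at t within I)" for i
  proof -
    have "smooth_fun_on A N (h i)"
      using metric N(1) b YO unfolding pseudo_riemannian_def h_def by blast
    from smooth_fun_along[OF t N(1,3) this] show ?thesis
      using metric_compatible[OF N(1) b YO N(2) v] by (simp add: h_def[abs_def] p_def)
  qed
  define x where "x s = coords (V s) c" for s
  define x' where "x' = vector_derivative x (at t within I)"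
  have x: "(x has_vector_derivative x') (at t within I)"
    using V unfolding x'_def vector_derivative_works[symmetric]
    by (simp add: x_def[abs_def] differentiable_along_def c_def p_def)
  have x_i: "((\<lambda>s. x s $ i) has_real_derivative x' $ i) (at t within I)" for i
    using bounded_linear.has_vector_derivative[OF bounded_linear_vec_nth x]
    by (simp add: has_real_derivative_iff_has_vector_derivative)
  have V_eq: "V s = (\<Sum>i\<in>UNIV. x s $ i *\<^sub>R ?b i (\<gamma> s))" if s: "s \<in> I" "\<gamma> s \<in> N" for s
  proof -
    have "V s = chart_vector A c (\<gamma> s) (x s)"
      using V s c by (simp add: differentiable_along_def x_def chart_vector_coords N_def)
    then show ?thesis using chart_vector_expansion[OF c(1)] s by (simp add: N_def)
  qed
  have g_eq: "g (\<gamma> s) (V s) (Y (\<gamma> s)) = (\<Sum>i\<in>UNIV. x s $ i * h i (\<gamma> s))"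
    if s: "s \<in> I" "\<gamma> s \<in> N" for s
    unfolding V_eq[OF s] h_def by (rule g_combination) (simp_all add: bT YT s)
  have "((\<lambda>s. \<Sum>i\<in>UNIV. x s $ i * h i (\<gamma> s)) has_real_derivative
      (\<Sum>i\<in>UNIV. x' $ i * h i p + x t $ i *
         (g p (D p ?v (?b i)) (Y p) + g p (?b i p) (D p ?v Y)))) (at t within I)"
    by (intro DERIV_sum) (use DERIV_mult[OF x_i h] in \<open>simp add: p_def add.commute mult.commute\<close>)
  then have "((\<lambda>s. g (\<gamma> s) (V s) (Y (\<gamma> s))) has_real_derivative
      (\<Sum>i\<in>UNIV. x' $ i * h i p + x t $ i *
         (g p (D p ?v (?b i)) (Y p) + g p (?b i p) (D p ?v Y)))) (at t within I)"
    unfolding has_field_derivative_def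
    by (rule has_derivative_transform_preimage[OF _ t N(1,3) g_eq])
  moreover have "g p (cov_deriv A D I \<gamma> V t) (Y p) =
      (\<Sum>i\<in>UNIV. x' $ i * h i p) + (\<Sum>i\<in>UNIV. x t $ i * g p (D p ?v (?b i)) (Y p))"
  proof -
    have Db: "D p ?v (?b i) \<in> tangent_space A p" for i
      by (rule D_tangent[OF N(1) b N(2) v])
    have "cov_deriv A D I \<gamma> V t =
       (\<Sum>i\<in>UNIV. x' $ i *\<^sub>R ?b i p) + (\<Sum>i\<in>UNIV. x t $ i *\<^sub>R D p ?v (?b i))"
      using chart_vector_expansion[OF c, of x']
      by (simp add: cov_deriv_def Let_def p_def[symmetric] c_def[symmetric] x'_def x_def[abs_def])
    then show ?thesis
      using N(2) by (simp add: g_left_linear(1) g_combination tangent_closed bT YT Db h_def)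
  qed
  moreover have "g p (V t) (D p ?v Y) = (\<Sum>i\<in>UNIV. x t $ i * g p (?b i p) (D p ?v Y))"
    using V_eq[OF t N(3)] N(2) g_combination[of "\<lambda>i. ?b i p" p "D p ?v Y"]
      D_tangent[OF N(1) YO N(2) v] by (simp add: bT p_def)
  ultimately show ?thesis
    by (simp add: p_def sum.distrib distrib_left add.assoc)
qed

text \<open>
  Expanding \<open>W\<close> in coordinate fields writes the function as a sum of products of coordinates of \<open>W\<close> with
  \<open>g(V, \<phi> \<partial>\<^sub>i)\<close>, and these are differentiable by the product rule.
\<close>

lemma continuous_on_g_phi_along:
  assumes V: "\<And>t. t \<in> I \<Longrightarrow> differentiable_along V t" and W: "\<And>t. t \<in> I \<Longrightarrow> differentiable_along W t"
  shows "continuous_on I (\<lambda>s. g (\<gamma> s) (V s) (\<phi> (\<gamma> s) (W s)))"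
  unfolding continuous_on_eq_continuous_within
proof
  fix t assume t: "t \<in> I"
  define c where "c = chart_at A (\<gamma> t)"
  have c: "c \<in> A" "\<gamma> t \<in> chart_dom c" using chart_at by (simp_all add: c_def)
  define U where "U = chart_dom c"
  have U: "open U" "\<gamma> t \<in> U" using c open_chart_dom by (simp_all add: U_def)
  let ?Y = "\<lambda>i q. \<phi> q (coord_field A c i q)"
  have Y: "vfield_on A U (?Y i)" for i
    unfolding U_def by (rule phi_vfield[OF open_chart_dom[OF c(1)] coord_field_vfield[OF c(1)]])
  have "\<exists>d. ((\<lambda>s. g (\<gamma> s) (V s) (?Y i (\<gamma> s))) has_derivative d) (at t within I)" for i
    using derivative_g_along[OF t V[OF t] U Y] unfolding has_field_derivative_def by blast
  then obtain d where
    d: "\<And>i. ((\<lambda>s. g (\<gamma> s) (V s) (?Y i (\<gamma> s))) has_derivative d i) (at t within I)"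
    by metis
  have "(\<lambda>s. coords (W s) c) differentiable (at t within I)"
    using W[OF t] by (simp add: differentiable_along_def c_def)
  then obtain w' where w': "((\<lambda>s. coords (W s) c) has_derivative w') (at t within I)"
    unfolding differentiable_def by blast
  have "((\<lambda>s. \<Sum>i\<in>UNIV. coords (W s) c $ i * g (\<gamma> s) (V s) (?Y i (\<gamma> s))) has_derivative
      (\<lambda>r. \<Sum>i\<in>UNIV. coords (W t) c $ i * d i r + w' r $ i * g (\<gamma> t) (V t) (?Y i (\<gamma> t)))) (at t within I)"
    by (intro has_derivative_sum has_derivative_mult d
        bounded_linear.has_derivative[OF bounded_linear_vec_nth w'])
  then have "((\<lambda>s. g (\<gamma> s) (V s) (\<phi> (\<gamma> s) (W s))) has_derivative
      (\<lambda>r. \<Sum>i\<in>UNIV. coords (W t) c $ i * d i r + w' r $ i * g (\<gamma> t) (V t) (?Y i (\<gamma> t)))) (at t within I)"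
  proof (rule has_derivative_transform_preimage[OF _ t U])
    fix s assume s: "s \<in> I" "\<gamma> s \<in> U"
    have T: "V s \<in> tangent_space A (\<gamma> s)" "W s \<in> tangent_space A (\<gamma> s)"
      "coord_field A c i (\<gamma> s) \<in> tangent_space A (\<gamma> s)" for i
      using V W s vfield_onD(1)[OF coord_field_vfield[OF c(1)]]
      by (auto simp: differentiable_along_def U_def)
    have W_eq: "W s = (\<Sum>i\<in>UNIV. coords (W s) c $ i *\<^sub>R coord_field A c i (\<gamma> s))"
      using chart_vector_coords[OF T(2) c(1)] chart_vector_expansion[OF c(1)] s
      by (simp add: U_def)
    have "\<phi> (\<gamma> s) (W s)
        = \<phi> (\<gamma> s) (\<Sum>i\<in>UNIV. coords (W s) c $ i *\<^sub>R coord_field A c i (\<gamma> s))"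
      using W_eq by (rule arg_cong)
    also have "\<dots> = (\<Sum>i\<in>UNIV. coords (W s) c $ i *\<^sub>R ?Y i (\<gamma> s))"
      using T by (simp add: sum_3 phi_linear tangent_closed)
    finally show "g (\<gamma> s) (V s) (\<phi> (\<gamma> s) (W s))
        = (\<Sum>i\<in>UNIV. coords (W s) c $ i * g (\<gamma> s) (V s) (?Y i (\<gamma> s)))"
      using T by (simp add: sum_3 g_right_linear tangent_closed)
  qed
  then show "continuous (at t within I) (\<lambda>s. g (\<gamma> s) (V s) (\<phi> (\<gamma> s) (W s)))"
    by (rule has_derivative_continuous)
qed

lemma D_xi_along:
  assumes "t \<in> I" "v \<in> tangent_space A (\<gamma> t)"
  shows "g (\<gamma> t) v (D (\<gamma> t) (velocity A I \<gamma> t) \<xi>) =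
    assoc_alpha A D \<xi> (\<gamma> t) * (g (\<gamma> t) v (velocity A I \<gamma> t)
        - \<eta> (\<gamma> t) (velocity A I \<gamma> t) * g (\<gamma> t) v (\<xi> (\<gamma> t)))
    + assoc_beta A D \<phi> \<xi> (\<gamma> t) * g (\<gamma> t) v (\<phi> (\<gamma> t) (velocity A I \<gamma> t))"
  using velocity_tangent[OF assms(1)] assms(2)
  by (simp add: D_xi g_right_linear tangent_closed)

end

section \<open>Algebra of the Frenet coefficients\<close>

text \<open>
  In an orthonormal basis of a plane, with square norms \<open>e2\<close> and \<open>e3\<close>, let \<open>x\<close> and \<open>p\<close> be orthogonal with
  square norms \<open>e1 q\<close> and \<open>- q\<close>. The Brahmagupta identity for \<open>(e2 x2\<^sup>2 + e3 x3\<^sup>2) (e2 p2\<^sup>2 + e3 p3\<^sup>2)\<close> determines the sign of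
  \<open>e2 e3\<close> and the square of the determinant of \<open>p\<close> and \<open>x\<close>. Given the determinant, \<open>p\<close> solves a linear system.
\<close>

lemma orthogonal_pair_in_plane:
  fixes x2 x3 p2 p3 q :: real
  assumes e: "e1 \<in> {1, -1}" "e2 \<in> {1, -1}" "e3 \<in> {1, -1::real}" and q: "q \<noteq> 0"
    and norm_x: "e2 * x2\<^sup>2 + e3 * x3\<^sup>2 = e1 * q"
    and norm_p: "e2 * p2\<^sup>2 + e3 * p3\<^sup>2 = - q"
    and orth: "e2 * p2 * x2 + e3 * p3 * x3 = 0"
  shows "e2 * e3 = - e1" and "(p2 * x3 - p3 * x2)\<^sup>2 = q\<^sup>2"
    and "p2 = (p2 * x3 - p3 * x2) / (e1 * q) * e3 * x3"
    and "p3 = - ((p2 * x3 - p3 * x2) / (e1 * q) * e2 * x2)"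
proof -
  let ?w = "p2 * x3 - p3 * x2"
  have ee: "e1 * e1 = 1" "e2 * e2 = 1" "e3 * e3 = 1" using e by auto
  have "(e2 * x2\<^sup>2 + e3 * x3\<^sup>2) * (e2 * p2\<^sup>2 + e3 * p3\<^sup>2)
      = (e2 * p2 * x2 + e3 * p3 * x3)\<^sup>2 + e2 * e3 * ?w\<^sup>2"
    by algebra
  then have *: "e1 * q\<^sup>2 = - (e2 * e3 * ?w\<^sup>2)"
    unfolding norm_x norm_p orth by (simp add: power2_eq_square algebra_simps)
  have "?w\<^sup>2 \<ge> 0" "q\<^sup>2 > 0" using q by simp_all
  then have "q\<^sup>2 \<noteq> - ?w\<^sup>2" "- q\<^sup>2 \<noteq> ?w\<^sup>2" by linarith+
  then show ees: "e2 * e3 = - e1"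
    using * e by auto
  have "e1 * e1 * q\<^sup>2 = e1 * e1 * ?w\<^sup>2"
    using * ees by (simp add: mult.assoc)
  then show "?w\<^sup>2 = q\<^sup>2" using ee by simp
  have "p2 * (e1 * q) = ?w * e3 * x3 + x2 * (e2 * p2 * x2 + e3 * p3 * x3)"
    unfolding norm_x[symmetric] by algebra
  then show "p2 = ?w / (e1 * q) * e3 * x3"
    using q e unfolding orth by (auto simp: field_simps)
  have "p3 * (e1 * q) = - (?w * e2 * x2) + x3 * (e2 * p2 * x2 + e3 * p3 * x3)"
    unfolding norm_x[symmetric] by algebra
  then show "p3 = - (?w / (e1 * q) * e2 * x2)"
    using q e unfolding orth by (auto simp: field_simps)
qed

text \<open>
  Here \<open>a\<close>, \<open>d\<close> are \<open>\<alpha>\<close>, \<open>\<delta>\<close> along the curve and \<open>a'\<close>, \<open>d'\<close> their derivatives, \<open>k'\<close> is the derivative of \<open>\<kappa>\<close>, and \<open>b\<close>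
  is \<open>\<beta>\<close>. Both \<open>a\<^sup>2 - e1 d\<^sup>2 = e1 e2 \<kappa>\<^sup>2 / q\<close> and \<open>a d' - a' d\<close> carry the factor \<open>\<kappa>\<^sup>2\<close>, and the quotient is a
  multiple of the Wronskian \<open>x2 x3' - x2' x3\<close>; the signed expression for the torsion equals
  \<open>- \<sigma> sgn q e1 \<tau>\<close>.
\<close>

lemma slant_frenet_algebra:
  fixes \<kappa> \<tau> :: real
  assumes e: "e1 \<in> {1, -1}" "e2 \<in> {1, -1}" "e3 \<in> {1, -1::real}" and q: "q \<noteq> 0"
    and \<sigma>: "\<sigma> \<in> {1, -1}" and ees: "e2 * e3 = - e1"
    and norm: "e2 * x2\<^sup>2 + e3 * x3\<^sup>2 = e1 * q" and pos: "\<kappa> > 0" "\<tau> > 0"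
    and a: "a = - (\<kappa> * e2 * x2) / q" and d: "d = - (e1 * \<sigma> * \<kappa> * x3) / \<bar>q\<bar>"
    and a': "a' = - (e2 * (k' * x2 + \<kappa> * x2')) / q"
    and d': "d' = - (e1 * \<sigma> * (k' * x3 + \<kappa> * x3')) / \<bar>q\<bar>"
    and x2': "x2' = - \<kappa> * e1 * c + \<tau> * e3 * x3 - c * a * x2 + b * \<sigma> * e3 * x3"
    and x3': "x3' = - \<tau> * e2 * x2 - c * a * x3 - b * \<sigma> * e2 * x2"
  shows "\<kappa> = sqrt (\<bar>q\<bar> * \<bar>a\<^sup>2 - e1 * d\<^sup>2\<bar>)"
    and "\<tau> = \<bar>sgn (e1 * q) * b + c * d + (a * d' - a' * d) / (a\<^sup>2 - e1 * d\<^sup>2)\<bar>"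
proof -
  define s where "s = sgn q"
  have q2: "q\<^sup>2 \<noteq> 0" using q by simp
  have abs_q: "\<bar>q\<bar> = q * s" and ss: "s * s = 1" and s_cases: "s = 1 \<or> s = -1"
    using q by (auto simp: s_def abs_if sgn_if)
  have ee: "e1 * e1 = 1" "e2 * e2 = 1" "e3 * e3 = 1" "\<sigma> * \<sigma> = 1" using e \<sigma> by auto
  have e3: "e3 = - e1 * e2" using ees ee(2) by algebra
  have sgn_e1q: "sgn (e1 * q) = e1 * s"
    using e by (auto simp: s_def sgn_mult)
  have inv_q: "y / \<bar>q\<bar> = y * s / q" for y
    using s_cases by (auto simp: abs_q)
  have "q\<^sup>2 * (a\<^sup>2 - e1 * d\<^sup>2) = \<kappa>\<^sup>2 * (e2 * e2 * x2\<^sup>2 - e1 * (e1 * e1) * (\<sigma> * \<sigma>) * (s * s) * x3\<^sup>2)"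
    unfolding a d inv_q using q by (simp add: field_simps power2_eq_square)
  also have "\<dots> = \<kappa>\<^sup>2 * e2 * (e2 * x2\<^sup>2 + e3 * x3\<^sup>2)"
    unfolding ee ss e3 using ee(2) by algebra
  finally have "q\<^sup>2 * (a\<^sup>2 - e1 * d\<^sup>2) = q\<^sup>2 * (\<kappa>\<^sup>2 * e1 * e2 / q)"
    unfolding norm using q by (simp add: power2_eq_square)
  then have N_eq: "a\<^sup>2 - e1 * d\<^sup>2 = \<kappa>\<^sup>2 * e1 * e2 / q"
    by (simp only: mult_left_cancel[OF q2])
  have "\<bar>a\<^sup>2 - e1 * d\<^sup>2\<bar> = \<kappa>\<^sup>2 / \<bar>q\<bar>"
    unfolding N_eq using e by (auto simp: abs_mult)
  then show "\<kappa> = sqrt (\<bar>q\<bar> * \<bar>a\<^sup>2 - e1 * d\<^sup>2\<bar>)"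
    using q pos by simp
  have wronskian: "x2 * x3' - x2' * x3 = - (\<tau> + b * \<sigma>) * (e1 * q) + \<kappa> * e1 * c * x3"
    unfolding norm[symmetric] x2' x3' by algebra
  have "q\<^sup>2 * (a * d' - a' * d) = \<kappa>\<^sup>2 * e1 * e2 * \<sigma> * s * (x2 * x3' - x2' * x3)"
    unfolding a d a' d' inv_q using q by (simp add: field_simps power2_eq_square)
  then have "q\<^sup>2 * (a * d' - a' * d)
      = q\<^sup>2 * ((\<kappa>\<^sup>2 * e1 * e2 / q) * (\<sigma> * s * (x2 * x3' - x2' * x3) / q))"
    using q by (simp add: power2_eq_square)
  then have "a * d' - a' * d = (\<kappa>\<^sup>2 * e1 * e2 / q) * (\<sigma> * s * (x2 * x3' - x2' * x3) / q)"
    by (simp only: mult_left_cancel[OF q2])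
  moreover have "\<kappa>\<^sup>2 * e1 * e2 / q \<noteq> 0"
    using pos e q by auto
  ultimately have "(a * d' - a' * d) / (a\<^sup>2 - e1 * d\<^sup>2) = \<sigma> * s * (x2 * x3' - x2' * x3) / q"
    unfolding N_eq by simp
  also have "\<dots> = - (\<sigma> * s * e1) * \<tau> - (\<sigma> * \<sigma>) * s * e1 * b + \<sigma> * s * \<kappa> * e1 * c * x3 / q"
    unfolding wronskian using q by (simp add: field_simps)
  also have "\<dots> = - (\<sigma> * s * e1) * \<tau> - e1 * s * b - c * d"
    unfolding d inv_q ee by simp
  finally have "sgn (e1 * q) * b + c * d + (a * d' - a' * d) / (a\<^sup>2 - e1 * d\<^sup>2) = - (\<sigma> * s * e1) * \<tau>"
    unfolding sgn_e1q by simp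
  also have "\<bar>\<dots>\<bar> = \<tau>"
    using e \<sigma> s_cases pos by auto
  finally show "\<tau> = \<bar>sgn (e1 * q) * b + c * d + (a * d' - a' * d) / (a\<^sup>2 - e1 * d\<^sup>2)\<bar>" ..
qed

section \<open>Curvature and torsion of slant Frenet curves\<close>

theorem theorem2p2:
  fixes A :: "'a::{t2_space, second_countable_topology} chart set"
    and \<phi> :: "'a \<Rightarrow> 'a tvec \<Rightarrow> 'a tvec" and \<xi> :: "'a \<Rightarrow> 'a tvec"
    and \<eta> :: "'a \<Rightarrow> 'a tvec \<Rightarrow> real" and g :: "'a \<Rightarrow> 'a tvec \<Rightarrow> 'a tvec \<Rightarrow> real"
    and D :: "'a connection" and \<alpha> \<beta> :: "'a \<Rightarrow> real"
    and I :: "real set" and \<gamma> :: "real \<Rightarrow> 'a" and E\<^sub>2 E\<^sub>3 :: "real \<Rightarrow> 'a tvec"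
    and \<epsilon>\<^sub>1 \<epsilon>\<^sub>2 \<epsilon>\<^sub>3 c :: real and \<kappa> \<tau> \<delta> :: "real \<Rightarrow> real"
  assumes manifold: "smooth_atlas A"
    and paracontact: "almost_paracontact_metric A \<phi> \<xi> \<eta> g"
    and connection: "levi_civita A g D"
    and normal: "normal_structure A \<phi> \<xi> \<eta>"
    and alpha: "\<alpha> = assoc_alpha A D \<xi>"
    and beta: "\<beta> = assoc_beta A D \<phi> \<xi>"
    and interval: "nondegenerate_interval I"
    and frenet: "frenet_curve3 A g D I \<gamma> E\<^sub>2 E\<^sub>3 \<epsilon>\<^sub>1 \<epsilon>\<^sub>2 \<epsilon>\<^sub>3 \<kappa> \<tau>"
    and slant: "slant_curve A \<eta> I \<gamma> c"
    and delta: "\<And>t. t \<in> I \<Longrightarrow> \<delta> t =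
        g (\<gamma> t) (cov_deriv A D I \<gamma> (velocity A I \<gamma>) t) (\<phi> (\<gamma> t) (velocity A I \<gamma> t))
        / \<bar>\<epsilon>\<^sub>1 - c\<^sup>2\<bar>"
  shows "\<forall>t\<in>I.
      \<kappa> t = sqrt (\<bar>\<epsilon>\<^sub>1 - c\<^sup>2\<bar> * \<bar>(\<alpha> (\<gamma> t))\<^sup>2 - \<epsilon>\<^sub>1 * (\<delta> t)\<^sup>2\<bar>) \<and>
      \<tau> t = \<bar>sgn (1 - \<epsilon>\<^sub>1 * c\<^sup>2) * \<beta> (\<gamma> t) + c * \<delta> t
              + (\<alpha> (\<gamma> t) * vector_derivative \<delta> (at t within I)
                 - vector_derivative (\<alpha> \<circ> \<gamma>) (at t within I) * \<delta> t)
                / ((\<alpha> (\<gamma> t))\<^sup>2 - \<epsilon>\<^sub>1 * (\<delta> t)\<^sup>2)\<bar>"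
proof -
  interpret normal_almost_paracontact_curve3 A \<phi> \<xi> \<eta> g D I \<gamma>
    using manifold paracontact connection normal interval frenet
    by unfold_locales (simp_all add: frenet_curve3_def Let_def)

  define E\<^sub>1 where "E\<^sub>1 = velocity A I \<gamma>"
  have eps: "\<epsilon>\<^sub>1 \<in> {1, -1}" "\<epsilon>\<^sub>2 \<in> {1, -1}" "\<epsilon>\<^sub>3 \<in> {1, -1}"
    and fields: "vfield_along A I \<gamma> E\<^sub>2" "vfield_along A I \<gamma> E\<^sub>3"
    and smooth: "smooth_on \<kappa> I"
    using frenet by (simp_all add: frenet_curve3_def Let_def)
  have norm: "g (\<gamma> t) (E\<^sub>1 t) (E\<^sub>1 t) = \<epsilon>\<^sub>1" "g (\<gamma> t) (E\<^sub>2 t) (E\<^sub>2 t) = \<epsilon>\<^sub>2"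
      "g (\<gamma> t) (E\<^sub>3 t) (E\<^sub>3 t) = \<epsilon>\<^sub>3"
    and orth: "g (\<gamma> t) (E\<^sub>1 t) (E\<^sub>2 t) = 0" "g (\<gamma> t) (E\<^sub>1 t) (E\<^sub>3 t) = 0" "g (\<gamma> t) (E\<^sub>2 t) (E\<^sub>3 t) = 0"
    and pos: "\<kappa> t > 0" "\<tau> t > 0"
    and cov: "cov_deriv A D I \<gamma> E\<^sub>1 t = (\<kappa> t * \<epsilon>\<^sub>2) *\<^sub>R E\<^sub>2 t"
      "cov_deriv A D I \<gamma> E\<^sub>2 t = - (\<kappa> t * \<epsilon>\<^sub>1) *\<^sub>R E\<^sub>1 t + (\<tau> t * \<epsilon>\<^sub>3) *\<^sub>R E\<^sub>3 t"
      "cov_deriv A D I \<gamma> E\<^sub>3 t = - (\<tau> t * \<epsilon>\<^sub>2) *\<^sub>R E\<^sub>2 t"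
    if "t \<in> I" for t
    using frenet that by (simp_all add: frenet_curve3_def Let_def E\<^sub>1_def)
  have along: "differentiable_along E\<^sub>1 t" "differentiable_along E\<^sub>2 t" "differentiable_along E\<^sub>3 t"
    if "t \<in> I" for t
    unfolding E\<^sub>1_def using differentiable_along_velocity differentiable_along_vfield fields that by blast+
  have T: "E\<^sub>1 t \<in> tangent_space A (\<gamma> t)" "E\<^sub>2 t \<in> tangent_space A (\<gamma> t)" "E\<^sub>3 t \<in> tangent_space A (\<gamma> t)"
    if "t \<in> I" for t
    using along[OF that] that by (simp_all add: differentiable_along_def)
  have eta_E1: "\<eta> (\<gamma> t) (E\<^sub>1 t) = c" if "t \<in> I" for t
    using slant that by (simp add: slant_curve_def E\<^sub>1_def)
  have eps_sq: "\<epsilon>\<^sub>1 * \<epsilon>\<^sub>1 = 1" "\<epsilon>\<^sub>2 * \<epsilon>\<^sub>2 = 1" "\<epsilon>\<^sub>3 * \<epsilon>\<^sub>3 = 1" using eps by auto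

  define q where "q = \<epsilon>\<^sub>1 - c\<^sup>2"
  define x2 where "x2 t = \<eta> (\<gamma> t) (E\<^sub>2 t)" for t
  define x3 where "x3 t = \<eta> (\<gamma> t) (E\<^sub>3 t)" for t
  define p2 where "p2 t = g (\<gamma> t) (E\<^sub>2 t) (\<phi> (\<gamma> t) (E\<^sub>1 t))" for t
  define p3 where "p3 t = g (\<gamma> t) (E\<^sub>3 t) (\<phi> (\<gamma> t) (E\<^sub>1 t))" for t
  define a where "a t = \<alpha> (\<gamma> t)" for t
  define b where "b t = \<beta> (\<gamma> t)" for t

  \<comment> \<open>The product rule with \<open>Y = \<xi>\<close>, after inserting the formula for \<open>\<nabla> \<xi>\<close>.\<close>
  have der: "((\<lambda>s. \<eta> (\<gamma> s) (V s)) has_real_derivative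
      \<eta> (\<gamma> t) (cov_deriv A D I \<gamma> V t)
      + (a t * (g (\<gamma> t) (V t) (E\<^sub>1 t) - c * \<eta> (\<gamma> t) (V t)) + b t * g (\<gamma> t) (V t) (\<phi> (\<gamma> t) (E\<^sub>1 t))))
      (at t within I)"
    if t: "t \<in> I" and V: "differentiable_along V t" and covT: "cov_deriv A D I \<gamma> V t \<in> tangent_space A (\<gamma> t)"
    for V t
  proof -
    have VT: "V s \<in> tangent_space A (\<gamma> s)" if "s \<in> I" for s
      using V that by (simp add: differentiable_along_def)
    have "((\<lambda>s. g (\<gamma> s) (V s) (\<xi> (\<gamma> s))) has_real_derivative
      \<eta> (\<gamma> t) (cov_deriv A D I \<gamma> V t)
      + (a t * (g (\<gamma> t) (V t) (E\<^sub>1 t) - c * \<eta> (\<gamma> t) (V t)) + b t * g (\<gamma> t) (V t) (\<phi> (\<gamma> t) (E\<^sub>1 t))))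
      (at t within I)"
      using derivative_g_along[OF t V open_UNIV UNIV_I xi_field] covT VT[OF t] eta_E1[OF t]
        D_xi_along[OF t VT[OF t]]
      by (simp add: E\<^sub>1_def[symmetric] a_def b_def alpha beta)
    then show ?thesis
      unfolding has_field_derivative_def
      by (rule has_derivative_transform[OF t, rotated]) (simp add: VT)
  qed

  have tangent_component: "\<kappa> t * \<epsilon>\<^sub>2 * x2 t = - (a t * q)" if t: "t \<in> I" for t
  proof -
    have "((\<lambda>s. \<eta> (\<gamma> s) (E\<^sub>1 s)) has_real_derivative \<kappa> t * \<epsilon>\<^sub>2 * x2 t + a t * q) (at t within I)"
      using der[OF t along(1)[OF t]] T[OF t] t
      by (simp add: cov[OF t] norm[OF t] eta_E1[OF t] eta_linear tangent_closed x2_def q_def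
          power2_eq_square)
    from derivative_of_constant_along[OF this t eta_E1]
    have "\<kappa> t * \<epsilon>\<^sub>2 * x2 t + a t * q = 0" by simp
    then show ?thesis by linarith
  qed
  have der_x2: "(x2 has_real_derivative - \<kappa> t * \<epsilon>\<^sub>1 * c + \<tau> t * \<epsilon>\<^sub>3 * x3 t - c * a t * x2 t + b t * p2 t)
      (at t within I)" if t: "t \<in> I" for t
    using der[OF t along(2)[OF t]] T[OF t] orth[OF t] eta_E1[OF t]
    by (simp add: cov[OF t] g_commute[of "E\<^sub>2 t" _ "E\<^sub>1 t"] eta_linear tangent_closed
        x2_def[abs_def] x3_def p2_def algebra_simps)
  have der_x3: "(x3 has_real_derivative - \<tau> t * \<epsilon>\<^sub>2 * x2 t - c * a t * x3 t + b t * p3 t)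
      (at t within I)" if t: "t \<in> I" for t
    using der[OF t along(3)[OF t]] T[OF t] orth[OF t]
    by (simp add: cov[OF t] g_commute[of "E\<^sub>3 t" _ "E\<^sub>1 t"] eta_linear tangent_closed
        x3_def[abs_def] x2_def p3_def algebra_simps)

  note inner = orthonormal_inner[OF T norm eps orth]
  have norm_x: "\<epsilon>\<^sub>2 * (x2 t)\<^sup>2 + \<epsilon>\<^sub>3 * (x3 t)\<^sup>2 = \<epsilon>\<^sub>1 * q" if t: "t \<in> I" for t
    using inner[OF t t t t t t t t t xi_tangent xi_tangent] T[OF t] eta_E1[OF t] eps_sq
    by (simp add: x2_def x3_def q_def power2_eq_square right_diff_distrib)
  have norm_p: "\<epsilon>\<^sub>2 * (p2 t)\<^sup>2 + \<epsilon>\<^sub>3 * (p3 t)\<^sup>2 = - q" if t: "t \<in> I" for t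
    using inner[OF t t t t t t t t t phi_tangent phi_tangent, OF T(1) T(1)] T[OF t] t eta_E1[OF t]
      g_compatible[OF T(1)[OF t] T(1)[OF t]] norm[OF t]
    by (simp add: p2_def p3_def q_def power2_eq_square)
  have orth_xp: "\<epsilon>\<^sub>2 * p2 t * x2 t + \<epsilon>\<^sub>3 * p3 t * x3 t = 0" if t: "t \<in> I" for t
    using inner[OF t t t t t t t t t phi_tangent xi_tangent, OF T(1)] T[OF t] t
    by (simp add: p2_def p3_def x2_def x3_def)

  obtain t0 where t0: "t0 \<in> I" using interval by (auto simp: nondegenerate_interval_def)
  \<comment> \<open>If \<open>q = 0\<close>, then \<open>x2\<close> vanishes identically and \<open>x3\<close> with it, so \<open>\<xi>\<close> is a multiple of \<open>E\<^sub>1\<close> and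
      \<open>\<phi> E\<^sub>1 = 0\<close>; the equation for the derivative of \<open>x2\<close> then forces \<open>\<kappa> = 0\<close>.\<close>
  have q: "q \<noteq> 0"
  proof
    assume q0: "q = 0"
    have x2_0: "x2 t = 0" if "t \<in> I" for t
      using tangent_component[OF that] pos[OF that] eps q0 by auto
    then have x3_0: "x3 t0 = 0"
      using norm_x[OF t0] q0 eps t0 by auto
    have c2: "c\<^sup>2 = \<epsilon>\<^sub>1" using q0 by (simp add: q_def)
    then have "c \<noteq> 0" using eps by auto
    have "\<xi> (\<gamma> t0) = (\<epsilon>\<^sub>1 * c) *\<^sub>R E\<^sub>1 t0"
      using orthonormal_expansion[OF T norm eps orth xi_tangent, of t0] T[OF t0] t0
        eta_E1[OF t0] x2_0[OF t0] x3_0 by (simp add: x2_def x3_def)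
    then have "\<phi> (\<gamma> t0) ((\<epsilon>\<^sub>1 * c) *\<^sub>R E\<^sub>1 t0) = 0"
      using phi_xi[of "\<gamma> t0"] by simp
    then have "\<phi> (\<gamma> t0) (E\<^sub>1 t0) = 0"
      using T[OF t0] eps \<open>c \<noteq> 0\<close> by (auto simp: phi_linear)
    then have p2_0: "p2 t0 = 0" using T[OF t0] by (simp add: p2_def)
    have "- \<kappa> t0 * \<epsilon>\<^sub>1 * c = 0"
      using derivative_of_constant_along[OF der_x2[OF t0] t0 x2_0] x2_0[OF t0] x3_0 p2_0 by simp
    then show False using \<open>c \<noteq> 0\<close> eps pos[OF t0] by auto
  qed

  \<comment> \<open>The determinant \<open>w\<close> is continuous with values in \<open>{q, - q}\<close>, hence constant.\<close>
  define w where "w t = p2 t * x3 t - p3 t * x2 t" for t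
  note plane = orthogonal_pair_in_plane[OF eps q norm_x norm_p orth_xp, folded w_def]
  have "continuous_on I w"
  proof -
    have "continuous_on I p2" "continuous_on I p3"
      using continuous_on_g_phi_along[OF along(2) along(1)] continuous_on_g_phi_along[OF along(3) along(1)]
      by (simp_all add: p2_def[abs_def] p3_def[abs_def])
    moreover have "continuous_on I x2" "continuous_on I x3"
      by (rule DERIV_continuous_on, erule der_x2) (rule DERIV_continuous_on, erule der_x3)
    ultimately show ?thesis
      unfolding w_def[abs_def] by (intro continuous_intros)
  qed
  moreover have "connected I"
    using interval by (simp add: nondegenerate_interval_def is_interval_connected)
  moreover have "w ` I \<subseteq> {q, - q}"
    using plane(2) by (auto simp: power2_eq_iff)
  then have "finite (w ` I)" by (rule finite_subset) simp
  ultimately have "w constant_on I"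
    using continuous_finite_range_constant by blast
  then have w_const: "w t = w t0" if "t \<in> I" for t
    using that t0 unfolding constant_on_def by metis
  define \<sigma> where "\<sigma> = w t0 / (\<epsilon>\<^sub>1 * q)"
  have \<sigma>: "\<sigma> \<in> {1, -1}"
    using plane(2)[OF t0 t0 t0] q eps by (auto simp: \<sigma>_def power2_eq_iff)
  have p2_eq: "p2 t = \<sigma> * \<epsilon>\<^sub>3 * x3 t" and p3_eq: "p3 t = - (\<sigma> * \<epsilon>\<^sub>2 * x2 t)" if t: "t \<in> I" for t
    using plane(3,4)[OF t t t] w_const[OF t] by (simp_all add: \<sigma>_def)
  have ees: "\<epsilon>\<^sub>2 * \<epsilon>\<^sub>3 = - \<epsilon>\<^sub>1" using plane(1)[OF t0 t0 t0] .

  have a_eq: "a t = - (\<kappa> t * \<epsilon>\<^sub>2 * x2 t) / q" if "t \<in> I" for t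
    using tangent_component[OF that] q by (simp add: field_simps)
  have delta_eq: "\<delta> t = - (\<epsilon>\<^sub>1 * \<sigma> * \<kappa> t * x3 t) / \<bar>q\<bar>" if t: "t \<in> I" for t
  proof -
    have "\<delta> t = \<kappa> t * \<epsilon>\<^sub>2 * p2 t / \<bar>q\<bar>"
      using delta[OF t] cov(1)[OF t] T[OF t]
      by (simp add: E\<^sub>1_def[symmetric] g_left_linear p2_def q_def)
    also have "\<kappa> t * \<epsilon>\<^sub>2 * p2 t = - (\<epsilon>\<^sub>1 * \<sigma> * \<kappa> t * x3 t)"
      unfolding p2_eq[OF t] using ees by algebra
    finally show ?thesis .
  qed

  show ?thesis
  proof
    fix t assume t: "t \<in> I"
    define X2 where "X2 = - \<kappa> t * \<epsilon>\<^sub>1 * c + \<tau> t * \<epsilon>\<^sub>3 * x3 t - c * a t * x2 t + b t * \<sigma> * \<epsilon>\<^sub>3 * x3 t"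
    define X3 where "X3 = - \<tau> t * \<epsilon>\<^sub>2 * x2 t - c * a t * x3 t - b t * \<sigma> * \<epsilon>\<^sub>2 * x2 t"
    have X2: "(x2 has_real_derivative X2) (at t within I)"
      using der_x2[OF t] by (simp add: X2_def p2_eq[OF t] mult.assoc)
    have X3: "(x3 has_real_derivative X3) (at t within I)"
      using der_x3[OF t] by (simp add: X3_def p3_eq[OF t] mult.assoc)
    have "Ck_on (Suc 0) \<kappa> I" using smooth unfolding smooth_on_def by blast
    then have "\<kappa> differentiable (at t within I)"
      using t by (simp add: differentiable_on_def)
    then obtain k' where k': "(\<kappa> has_real_derivative k') (at t within I)"
      unfolding real_differentiable_def by blast
    have "((\<lambda>s. - (\<kappa> s * \<epsilon>\<^sub>2 * x2 s)) has_real_derivative - (\<epsilon>\<^sub>2 * (k' * x2 t + \<kappa> t * X2)))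
        (at t within I)"
      by (rule derivative_eq_intros k' X2 refl)+ (simp add: algebra_simps)
    from vector_derivative_along[OF
        DERIV_cdivide[OF this, of q, unfolded has_real_derivative_iff_has_vector_derivative] t]
    have a': "vector_derivative (\<alpha> \<circ> \<gamma>) (at t within I) = - (\<epsilon>\<^sub>2 * (k' * x2 t + \<kappa> t * X2)) / q"
      using a_eq by (simp add: a_def)
    have "((\<lambda>s. - (\<epsilon>\<^sub>1 * \<sigma> * \<kappa> s * x3 s)) has_real_derivative
        - (\<epsilon>\<^sub>1 * \<sigma> * (k' * x3 t + \<kappa> t * X3))) (at t within I)"
      by (rule derivative_eq_intros k' X3 refl)+ (simp add: algebra_simps)
    from vector_derivative_along[OF
        DERIV_cdivide[OF this, of "\<bar>q\<bar>", unfolded has_real_derivative_iff_has_vector_derivative]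
        t delta_eq]
    have d': "vector_derivative \<delta> (at t within I) = - (\<epsilon>\<^sub>1 * \<sigma> * (k' * x3 t + \<kappa> t * X3)) / \<bar>q\<bar>" .
    have sgn_arg: "1 - \<epsilon>\<^sub>1 * c\<^sup>2 = \<epsilon>\<^sub>1 * q"
      using eps_sq by (simp add: q_def right_diff_distrib)
    show "\<kappa> t = sqrt (\<bar>\<epsilon>\<^sub>1 - c\<^sup>2\<bar> * \<bar>(\<alpha> (\<gamma> t))\<^sup>2 - \<epsilon>\<^sub>1 * (\<delta> t)\<^sup>2\<bar>) \<and>
      \<tau> t = \<bar>sgn (1 - \<epsilon>\<^sub>1 * c\<^sup>2) * \<beta> (\<gamma> t) + c * \<delta> t
              + (\<alpha> (\<gamma> t) * vector_derivative \<delta> (at t within I)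
                 - vector_derivative (\<alpha> \<circ> \<gamma>) (at t within I) * \<delta> t)
                / ((\<alpha> (\<gamma> t))\<^sup>2 - \<epsilon>\<^sub>1 * (\<delta> t)\<^sup>2)\<bar>"
      unfolding sgn_arg q_def[symmetric] a_def[symmetric] b_def[symmetric]
      using slant_frenet_algebra[OF eps q \<sigma> ees norm_x[OF t] pos[OF t] a_eq[OF t] delta_eq[OF t]
          a' d' X2_def X3_def] by blast
  qed
qed

end
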